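(* Let $k\ge 1$ and consider one forward Euler step, from $t^n$ to $t^{n+1}=t^n+\Delta t$, of the $\mathbb{P}^k$-based PosDiv-CDG method for the two-dimensional ideal compressible MHD equations, as described in the context. The data at time $t^n$ are: full cell averages $\overline{\mathbf U}^{\star,C}_{i,j}\in\mathcal G$ and $\overline{\mathbf U}^{\star,D}_{i+\frac12,j+\frac12}\in\mathcal G$ for all $i,j$; piecewise polynomial fields $\mathbf R_h^{\sharp}$; and globally divergence-free magnetic fields $\mathbf Q_h^{\sharp}$, $\sharp\in\{C,D\}$. Assume that the modified dissipation terms are constructed with the improved (Cui--Ding--Wu) cell average decomposition, with constant $\overline\omega_\star$. Set $$\hat\alpha_1=\max_{\sigma=\pm1}\Big\{\max_{i,j,\mu}\alpha_1\big(\widetilde{\mathbf U}^{(\mu),D}_{i+\frac12,j+\frac\sigma4},\widetilde{\mathbf U}^{(\mu),D}_{i-\frac12,j+\frac\sigma4}\big),\ \max_{i,j,\mu}\alpha_1\big(\widetilde{\mathbf U}^{(\mu),C}_{i+1,j+\frac12+\frac\sigma4},\widetilde{\mathbf U}^{(\mu),C}_{i,j+\frac12+\frac\sigma4}\big)\Big\},$$ $$\hat\alpha_2=\max_{\sigma=\pm1}\Big\{\max_{i,j,\mu}\alpha_2\big(\widetilde{\mathbf U}^{(\mu),D}_{i+\frac\sigma4,j+\frac12},\widetilde{\mathbf U}^{(\mu),D}_{i+\frac\sigma4,j-\frac12}\big),\ \max_{i,j,\mu}\alpha_2\big(\widetilde{\mathbf U}^{(\mu),C}_{i+\frac12+\frac\sigma4,j+1},\widetilde{\mathbf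 U}^{(\mu),C}_{i+\frac12+\frac\sigma4,j}\big)\Big\}.$$ If the CFL-type condition $$\Delta t\left(\frac{\hat\alpha_1}{\Delta x}+\frac{\hat\alpha_2}{\Delta y}\right)\le\frac{\theta\,\overline\omega_\star}{2},\qquad \theta:=\frac{\Delta t}{\tau_{\max}}\in(0,1],$$ holds, then the updated cell averages are admissible: $\overline{\mathbf U}^{\star,C,n+1}_{i,j}\in\mathcal G_*$ and $\overline{\mathbf U}^{\star,D,n+1}_{i+\frac12,j+\frac12}\in\mathcal G_*$ for all $i,j$.
   Context: **MHD system.** The conservative variables are $\mathbf U=(\rho,\boldsymbol m,\boldsymbol B,E)^\top\in\mathbb R^8$, with $\boldsymbol m=(m_1,m_2,m_3)$, $\boldsymbol B=(B_1,B_2,B_3)$, $\boldsymbol u=\boldsymbol m/\rho$ and $E=\rho e+\frac12\rho|\boldsymbol u|^2+\frac12|\boldsymbol B|^2$. The pressure is $p=p(\rho,e)$, an equation of state such that for every $\rho>0$: $e>0$ if and only if $p(\rho,e)>0$. Set $p_{\rm tot}=p+\frac12|\boldsymbol B|^2$. For $\ell=1,2,3$ the flux is $$\mathbf F_\ell(\mathbf U)=\big(m_\ell,\ m_\ell\boldsymbol u-B_\ell\boldsymbol B+p_{\rm tot}\boldsymbol e_\ell,\ u_\ell\boldsymbol B-B_\ell\boldsymbol u,\ u_\ell(E+p_{\rm tot})-B_\ell(\boldsymbol u\cdot\boldsymbol B)\big)^\top,$$ where $\boldsymbol e_\ell$ is the $\ell$-th unit vector of $\mathbb R^3$. In two space dimensions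 the system is $\partial_t\mathbf U+\partial_x\mathbf F_1(\mathbf U)+\partial_y\mathbf F_2(\mathbf U)=0$. Split $\mathbf U$ into $\mathbf R=(\rho,m_1,m_2,m_3,B_3,E)^\top$ and $\mathbf Q=(B_1,B_2)^\top$. **Admissible sets.** With $\mathcal E(\mathbf U)=E-\frac12\big(|\boldsymbol m|^2/\rho+|\boldsymbol B|^2\big)$, let $\mathcal G=\{\mathbf U:\rho>0,\ \mathcal E(\mathbf U)>0\}$. With $\boldsymbol n_1=(1,0,\dots,0)^\top\in\mathbb R^8$ and $\boldsymbol n^*=(\frac{|\boldsymbol u^*|^2}{2},-\boldsymbol u^*,-\boldsymbol B^*,1)^\top$, let $$\mathcal G_*=\{\mathbf U:\ \mathbf U\cdot\boldsymbol n_1>0,\ \ \mathbf U\cdot\boldsymbol n^*+\tfrac12|\boldsymbol B^*|^2>0\ \ \forall\,\boldsymbol u^*,\boldsymbol B^*\in\mathbb R^3\}.$$ (It is known that $\mathcal G_*=\mathcal G$.) **Wave speed bounds.** For $\mathbf U,\widetilde{\mathbf U}\in\mathcal G$ (tildes denote quantities of $\widetilde{\mathbf U}$), $$\alpha_\ell(\mathbf U,\widetilde{\mathbf U})=\max\Big\{|u_\ell|+\mathcal C_\ell,\ |\tilde u_\ell|+\tilde{\mathcal C}_\ell,\ \frac{|\sqrt\rho\,u_\ell+\sqrt{\tilde\rho}\,\tilde u_\ell|}{\sqrt\rho+\sqrt{\tilde\rho}}+\max\{\mathcal C_\ell,\tilde{\mathcal C}_\ell\}\Big\}+\frac{|\boldsymbol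 B-\widetilde{\boldsymbol B}|}{\sqrt\rho+\sqrt{\tilde\rho}},$$ $$\mathcal C_\ell=\frac1{\sqrt2}\Big[\mathcal C_s^2+\frac{|\boldsymbol B|^2}{\rho}+\sqrt{\Big(\mathcal C_s^2+\frac{|\boldsymbol B|^2}{\rho}\Big)^2-\frac{4\mathcal C_s^2B_\ell^2}{\rho}}\Big]^{1/2},\qquad \mathcal C_s=\frac{p}{\rho\sqrt{2e}}.$$ **Meshes.** Uniform overlapping Cartesian meshes with spacings $\Delta x,\Delta y$: primal cells $C_{i,j}=[x_{i-\frac12},x_{i+\frac12}]\times[y_{j-\frac12},y_{j+\frac12}]$ and dual cells $D_{i+\frac12,j+\frac12}=[x_i,x_{i+1}]\times[y_j,y_{j+1}]$, where $x_i,y_j$ are the midpoints of the primal intervals. Boundary data are such that all formulas below make sense for every cell considered (e.g. periodic). For $\sharp\in\{C,D\}$ let $\natural$ be the other mesh label. Each cell $K$ of mesh $\sharp$ is the union of four equal quarter rectangles $K_{\sigma',\sigma}$, $\sigma',\sigma\in\{\pm1\}$ (right/left, top/bottom), each contained in exactly one cell of mesh $\natural$. **Data at time $t^n$** (the superscript $n$ is dropped). On each cell of mesh $\sharp$, $\mathbf R_h^\sharp$ is a polynomial vector of total degree at most $k$; its cell average is $\overline{\mathbf R}^{\star,\sharp}$. The field $\mathbf Q_h^\sharp=(B_1,B_2)^\top$ is polynomial on each cell (of total degree at most $k+1$, so that the $(k+1)$-point Gauss rule integrates its normal components along edges exactly) and is globally divergence-free: it is divergence-free inside each cell and its normal component is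 continuous across the interfaces of mesh $\sharp$. In addition, each cell carries an auxiliary magnetic average $\overline{\mathbf Q}^{\star,\sharp}\in\mathbb R^2$, evolved separately and not required to equal the average of $\mathbf Q_h^\sharp$. The full cell average $\overline{\mathbf U}^{\star,\sharp}$ is composed of $\overline{\mathbf R}^{\star,\sharp}$ and $\overline{\mathbf Q}^{\star,\sharp}$. (The method's oscillation-suppression step only alters higher moments of $\mathbf R_h^\sharp$, not its cell averages; $\mathbf R_h^\sharp$ denotes the result after that step.) **Gauss rule.** $N=k+1$ Gauss nodes with weights $\omega_\mu>0$, $\sum_\mu\omega_\mu=1$, mapped to each half interval. Write $x^{(\mu)}_{i\pm\frac14}$ for the nodes on the half intervals with midpoints $x_{i\pm\frac14}=x_i\pm\Delta x/4$, and similarly $y^{(\mu)}_{j\pm\frac14}$. **Cell average decomposition (CAD).** On every quarter rectangle a quadrature rule, exact on $\mathbb P^k$, is used. It has internal nodes with weights $\widetilde\omega_s>0$, $s=1,\dots,S$ (possibly $S=0$); the $N$ Gauss nodes on each of the left and right edges with weights $\widetilde\omega_x\omega_\mu$; and the $N$ Gauss nodes on each of the bottom and top edges with weights $\widetilde\omega_y\omega_\mu$. Here $2\widetilde\omega_x+2\widetilde\omega_y+\sum_s\widetilde\omega_s=1$. In the improved (Cui--Ding--Wu) CAD, $$\widetilde\omega_x=\frac{\overline\omega_\star a_1/\Delta x}{a_1/\Delta x+a_2/\Delta y},\qquad \widetilde\omega_y=\frac{\overline\omega_\star a_2/\Delta y}{a_1/\Delta x+a_2/\Delta y},\qquad \zeta=\frac{a_1/\Delta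 x-a_2/\Delta y}{a_1/\Delta x+a_2/\Delta y},$$ where $a_1,a_2$ are the maximal wave speeds in the $x$- and $y$-directions, taken to be $a_\ell=\hat\alpha_\ell$. The constant is $\overline\omega_\star=\frac12$ for $k=1$; $\overline\omega_\star=\frac1{4+2|\zeta|}$ for $k=2,3$; and for $k=4,5$ $$\overline\omega_\star=\Big[\tfrac{14}{3}+\tfrac23\sqrt{78\zeta^2+46}\,\cos\Big(\tfrac13\arccos\tfrac{1476\zeta^2-244}{(78\zeta^2+46)^{3/2}}\Big)\Big]^{-1}.$$ For $k\ge6$, $\overline\omega_\star$ is the corresponding constant, depending on $k$ and $\zeta$, of the CAD of this form given in the literature of Cui, Ding and Wu. **Positivity-limited point values.** Fix a cell of mesh $\sharp$ and write $\overline{\mathbf U}=\overline{\mathbf U}^{\star,\sharp}$ for its full cell average, with density $\overline\rho$. Let $\mathbf U^{(q)}$, $q=1,\dots,Q$, be the values, computed from the polynomials of that cell, of $\mathbf U_h^\sharp=(\mathbf R_h^\sharp,\mathbf Q_h^\sharp)$ at all of the following points in the cell's four quarter rectangles: CAD nodes, tensor-product Gauss nodes, and the four corners of each quarter. 1. Let $\epsilon_\rho=\min\{10^{-13},\overline\rho\}$ and $\theta_\rho=\min\{\frac{\overline\rho-\epsilon_\rho}{\overline\rho-\min_q\rho^{(q)}},1\}$. Replace only the density in $\mathbf U^{(q)}$, by $(1-\theta_\rho)\overline\rho+\theta_\rho\rho^{(q)}$, to obtain $\check{\mathbf U}^{(q)}$. 2. Let $\epsilon_{\rho e}=\min\{10^{-13},\mathcal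 E(\overline{\mathbf U})\}$ and $\theta_{\rho e}=\min\{\frac{\mathcal E(\overline{\mathbf U})-\epsilon_{\rho e}}{\mathcal E(\overline{\mathbf U})-\min_q\mathcal E(\check{\mathbf U}^{(q)})},1\}$. Set $\widehat{\mathbf U}^{(q)}=(1-\theta_{\rho e})\overline{\mathbf U}+\theta_{\rho e}\check{\mathbf U}^{(q)}$. (In both steps the scaling factor is $1$ if no limiting is needed.) 3. Convert $\widehat{\mathbf U}^{(q)}$ to primitive variables $(\hat\rho,\hat{\boldsymbol u},\hat B_1,\hat B_2,\hat B_3,\hat p)$ and replace $(\hat B_1,\hat B_2)$ by the original values $(B_1,B_2)$ of $\mathbf Q_h^\sharp$ at that point. Convert back to conservative variables to get $\widetilde{\mathbf U}^{(q)}$, i.e. $\hat\rho,\hat{\boldsymbol u},\hat B_3,\hat p$ (and hence the internal energy) are kept and the total energy is recomputed. Then $\widetilde{\mathbf U}^{(q)}\in\mathcal G$. Notation: $\widetilde{\mathbf U}^{(\mu),D}_{i\pm\frac12,j+\frac\sigma4}$ is the limited value of the mesh-$D$ solution at $(x_{i\pm\frac12},y^{(\mu)}_{j+\frac\sigma4})$, and $\widetilde{\mathbf U}^{(\mu),D}_{i+\frac\sigma4,j\pm\frac12}$ the one at $(x^{(\mu)}_{i+\frac\sigma4},y_{j\pm\frac12})$. The values with superscript $C$ and indices shifted by $\frac12$ are the analogous limited values of the mesh-$C$ solution at the Gauss points on the edges of the dual cells, e.g. $\widetilde{\mathbf U}^{(\mu),C}_{i,j+\frac12+\frac\sigma4}$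 at $x=x_i$ and the $\mu$-th Gauss node of the half interval with midpoint $y_j+\frac{\Delta y}{2}+\frac{\sigma\Delta y}{4}$. **Update of cell averages.** $\tau_{\max}$ is the maximal time step allowed by the CFL condition and $\theta=\Delta t/\tau_{\max}$. For a primal cell, $$\overline{\mathbf U}^{\star,C,n+1}_{i,j}=(1-\theta)\overline{\mathbf U}^{\star,C}_{i,j}+\theta\,\boldsymbol\Pi^D_{i,j}+\Delta t\,\boldsymbol\Pi^F_{i,j}.$$ Here $\boldsymbol\Pi^D_{i,j}$ (from the modified dissipation term) is the average over the four quarter rectangles of $C_{i,j}$ of the CAD quadrature sums, in which at each node one uses the limited value $\widetilde{\mathbf U}^{D}$ belonging to the dual cell containing that quarter. The flux term is $$\boldsymbol\Pi^F_{i,j}=-\frac1{\Delta x}\sum_{\sigma=\pm1}\sum_{\mu=1}^N\frac{\omega_\mu}2\Big(\mathbf F_1(\widetilde{\mathbf U}^{(\mu),D}_{i+\frac12,j+\frac\sigma4})-\mathbf F_1(\widetilde{\mathbf U}^{(\mu),D}_{i-\frac12,j+\frac\sigma4})\Big)-\frac1{\Delta y}\sum_{\sigma=\pm1}\sum_{\mu=1}^N\frac{\omega_\mu}2\Big(\mathbf F_2(\widetilde{\mathbf U}^{(\mu),D}_{i+\frac\sigma4,j+\frac12})-\mathbf F_2(\widetilde{\mathbf U}^{(\mu),D}_{i+\frac\sigma4,j-\frac12})\Big).$$ (The $\mathbf R$-components are the zeroth-moment CDG update for $\mathbf R$; the $(B_1,B_2)$-components are the update of the auxiliary magnetic averages.)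 The update of $\overline{\mathbf U}^{\star,D,n+1}_{i+\frac12,j+\frac12}$ is the same formula with the roles of $C$ and $D$ exchanged and all indices shifted by $\frac12$. *)

theory Defs
  imports "HOL-Analysis.Analysis" "HOL-Computational_Algebra.Polynomial"
begin

section \<open>The ideal MHD system\<close>

text \<open>Conservative variables \<open>U = (\<rho>, m, B, E)\<close>.  The product type is an 8-dimensional
  Euclidean space whose inner product is the usual one of \<open>\<real>\<^sup>8\<close>.\<close>

type_synonym state = "real \<times> (real^3) \<times> (real^3) \<times> real"

definition rho :: "state \<Rightarrow> real" where "rho U = fst U"
definition mom :: "state \<Rightarrow> real^3" where "mom U = fst (snd U)"
definition mag :: "state \<Rightarrow> real^3" where "mag U = fst (snd (snd U))"
definition energy :: "state \<Rightarrow> real" where "energy U = snd (snd (snd U))"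

definition vel :: "state \<Rightarrow> real^3" where
  "vel U = (1 / rho U) *\<^sub>R mom U"

definition Eint :: "state \<Rightarrow> real" where
  "Eint U = energy U - 1/2 * ((norm (mom U))\<^sup>2 / rho U + (norm (mag U))\<^sup>2)"

text \<open>Specific internal energy \<open>e\<close>, from \<open>E = \<rho> e + \<rho> |u|\<^sup>2 / 2 + |B|\<^sup>2 / 2\<close>.\<close>

definition sie :: "state \<Rightarrow> real" where
  "sie U = Eint U / rho U"

definition conserved :: "real \<Rightarrow> real^3 \<Rightarrow> real^3 \<Rightarrow> real \<Rightarrow> state" where
  "conserved r u B e = (r, r *\<^sub>R u, B, r * e + 1/2 * r * (norm u)\<^sup>2 + 1/2 * (norm B)\<^sup>2)"

definition is_eos :: "(real \<Rightarrow> real \<Rightarrow> real) \<Rightarrow> bool" where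
  "is_eos p \<longleftrightarrow> (\<forall>r e. r > 0 \<longrightarrow> (e > 0 \<longleftrightarrow> p r e > 0))"

definition ptot :: "(real \<Rightarrow> real \<Rightarrow> real) \<Rightarrow> state \<Rightarrow> real" where
  "ptot p U = p (rho U) (sie U) + 1/2 * (norm (mag U))\<^sup>2"

definition flux :: "(real \<Rightarrow> real \<Rightarrow> real) \<Rightarrow> 3 \<Rightarrow> state \<Rightarrow> state" where
  "flux p l U =
    (mom U $ l,
     (mom U $ l) *\<^sub>R vel U - (mag U $ l) *\<^sub>R mag U + ptot p U *\<^sub>R axis l 1,
     (vel U $ l) *\<^sub>R mag U - (mag U $ l) *\<^sub>R vel U,
     vel U $ l * (energy U + ptot p U) - mag U $ l * (vel U \<bullet> mag U))"

definition Gset :: "state set" where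
  "Gset = {U. rho U > 0 \<and> Eint U > 0}"

definition nstar :: "real^3 \<Rightarrow> real^3 \<Rightarrow> state" where
  "nstar us Bs = ((norm us)\<^sup>2 / 2, - us, - Bs, 1)"

definition Gstar :: "state set" where
  "Gstar = {U. U \<bullet> (1, 0, 0, 0) > 0 \<and>
               (\<forall>us Bs. U \<bullet> nstar us Bs + 1/2 * (norm Bs)\<^sup>2 > 0)}"

definition Cs :: "(real \<Rightarrow> real \<Rightarrow> real) \<Rightarrow> state \<Rightarrow> real" where
  "Cs p U = p (rho U) (sie U) / (rho U * sqrt (2 * sie U))"

definition Cfast :: "(real \<Rightarrow> real \<Rightarrow> real) \<Rightarrow> 3 \<Rightarrow> state \<Rightarrow> real" where
  "Cfast p l U =
    (let b = (Cs p U)\<^sup>2 + (norm (mag U))\<^sup>2 / rho U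
     in 1 / sqrt 2 * sqrt (b + sqrt (b\<^sup>2 - 4 * (Cs p U)\<^sup>2 * (mag U $ l)\<^sup>2 / rho U)))"

definition alpha :: "(real \<Rightarrow> real \<Rightarrow> real) \<Rightarrow> 3 \<Rightarrow> state \<Rightarrow> state \<Rightarrow> real" where
  "alpha p l U V =
    Max {\<bar>vel U $ l\<bar> + Cfast p l U,
         \<bar>vel V $ l\<bar> + Cfast p l V,
         \<bar>sqrt (rho U) * vel U $ l + sqrt (rho V) * vel V $ l\<bar> / (sqrt (rho U) + sqrt (rho V))
           + max (Cfast p l U) (Cfast p l V)}
    + norm (mag U - mag V) / (sqrt (rho U) + sqrt (rho V))"


section \<open>Overlapping Cartesian meshes\<close>

text \<open>The primal cell \<open>C\<^bsub>i,j\<^esub>\<close> and the dual cell \<open>D\<^bsub>i+1/2,j+1/2\<^esub>\<close> both carry the index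
  \<open>(i,j)\<close>.  Boundaries: \<open>cells\<close> are the cells on which data are given (ghost cells included),
  \<open>active\<close> those which are updated.  In the periodic case both can be \<open>UNIV\<close>.\<close>

datatype mesh = Primal | Dual

fun other :: "mesh \<Rightarrow> mesh" where
  "other Primal = Dual"
| "other Dual = Primal"

type_synonym cell = "int \<times> int"

record grid =
  xorg :: real
  yorg :: real
  dx :: real
  dy :: real
  cells :: "mesh \<Rightarrow> cell set"
  active :: "mesh \<Rightarrow> cell set"

definition shift :: "mesh \<Rightarrow> real" where
  "shift sh = (case sh of Primal \<Rightarrow> 0 | Dual \<Rightarrow> 1/2)"

definition xc :: "grid \<Rightarrow> mesh \<Rightarrow> cell \<Rightarrow> real" where
  "xc g sh c = xorg g + (of_int (fst c) + shift sh) * dx g"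

definition yc :: "grid \<Rightarrow> mesh \<Rightarrow> cell \<Rightarrow> real" where
  "yc g sh c = yorg g + (of_int (snd c) + shift sh) * dy g"

definition cell_box :: "grid \<Rightarrow> mesh \<Rightarrow> cell \<Rightarrow> (real \<times> real) set" where
  "cell_box g sh c = cbox (xc g sh c - dx g / 2, yc g sh c - dy g / 2)
                          (xc g sh c + dx g / 2, yc g sh c + dy g / 2)"

text \<open>Affine map from the reference square \<open>[-1/2,1/2]\<^sup>2\<close> onto the quarter \<open>K\<^bsub>s,t\<^esub>\<close>
  (\<open>s,t \<in> {-1,1}\<close>) of the cell \<open>c\<close> of mesh \<open>sh\<close>.\<close>

definition qpoint :: "grid \<Rightarrow> mesh \<Rightarrow> cell \<Rightarrow> int \<Rightarrow> int \<Rightarrow> real \<times> real \<Rightarrow> real \<times> real" where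
  "qpoint g sh c s t z =
    (xc g sh c + of_int s * dx g / 4 + fst z * dx g / 2,
     yc g sh c + of_int t * dy g / 4 + snd z * dy g / 2)"

text \<open>Index of the cell of the other mesh which contains the quarter \<open>K\<^bsub>s,t\<^esub>\<close>
  (see \<open>qpoint_nbr\<close> and \<open>quarter_subset_nbr\<close> below).\<close>

definition nbr :: "mesh \<Rightarrow> int \<Rightarrow> int \<Rightarrow> cell \<Rightarrow> cell" where
  "nbr sh s t c = (case sh of
      Primal \<Rightarrow> (if s = 1 then fst c else fst c - 1, if t = 1 then snd c else snd c - 1)
    | Dual \<Rightarrow> (if s = 1 then fst c + 1 else fst c, if t = 1 then snd c + 1 else snd c))"

lemma qpoint_nbr:
  assumes "s \<in> {-1, 1}" "t \<in> {-1, 1}"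
  shows "qpoint g (other sh) (nbr sh s t c) (- s) (- t) z = qpoint g sh c s t z"
  using assms by (cases sh) (auto simp: qpoint_def nbr_def xc_def yc_def shift_def field_simps)

lemma quarter_subset_cell:
  assumes "s \<in> {-1, 1}" "t \<in> {-1, 1}" "dx g > 0" "dy g > 0"
  shows "qpoint g sh c s t ` cbox (-1/2, -1/2) (1/2, 1/2) \<subseteq> cell_box g sh c"
proof -
  have bnd: "- (d / 2) \<le> of_int s * d / 4 + a * d / 2 \<and> of_int s * d / 4 + a * d / 2 \<le> d / 2"
    if s: "s \<in> {-1, 1::int}" and "d > 0" "-1/2 \<le> a" "a \<le> 1/2" for s and a d :: real
  proof -
    have ad: "-1/2 * d \<le> a * d" "a * d \<le> 1/2 * d"
      using that by (intro mult_right_mono; simp)+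
    have "real_of_int s = 1 \<or> real_of_int s = -1"
      using s by auto
    then show ?thesis
    proof
      assume s1: "real_of_int s = 1"
      show ?thesis unfolding s1 using ad by linarith
    next
      assume s1: "real_of_int s = -1"
      show ?thesis unfolding s1 using ad by linarith
    qed
  qed
  show ?thesis
    using bnd[OF assms(1,3)] bnd[OF assms(2,4)]
    by (fastforce simp: qpoint_def cell_box_def cbox_Pair_eq)
qed

lemma quarter_subset_nbr:
  assumes "s \<in> {-1, 1}" "t \<in> {-1, 1}" "dx g > 0" "dy g > 0"
  shows "qpoint g sh c s t ` cbox (-1/2, -1/2) (1/2, 1/2) \<subseteq> cell_box g (other sh) (nbr sh s t c)"
  using quarter_subset_cell[of "- s" "- t" g "other sh" "nbr sh s t c"] assms
  by (auto simp: qpoint_nbr)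

definition valid_grid :: "grid \<Rightarrow> bool" where
  "valid_grid g \<longleftrightarrow> dx g > 0 \<and> dy g > 0 \<and>
    (\<forall>sh. \<forall>c \<in> active g sh. c \<in> cells g sh \<and>
       (\<forall>s \<in> {-1, 1}. \<forall>t \<in> {-1, 1}. nbr sh s t c \<in> cells g (other sh)))"


section \<open>Polynomials and quadrature\<close>

definition poly2 :: "nat \<Rightarrow> (real \<times> real \<Rightarrow> 'a::real_vector) \<Rightarrow> bool" where
  "poly2 d f \<longleftrightarrow>
    (\<exists>a. \<forall>x y. f (x, y) = (\<Sum>i\<le>d. \<Sum>j\<le>d - i. (x ^ i * y ^ j) *\<^sub>R a i j))"

text \<open>One-dimensional rule (\<open>gnum\<close>, \<open>gnode\<close>, \<open>gwt\<close>) on \<open>[-1/2,1/2]\<close>; CAD on the reference square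
  with internal nodes \<open>cnode s\<close> and weights \<open>cwt s\<close>, \<open>s < cnum\<close>, and edge weights
  \<open>cwx * gwt \<mu>\<close>, \<open>cwy * gwt \<mu>\<close>.\<close>

record quadrature =
  gnum :: nat
  gnode :: "nat \<Rightarrow> real"
  gwt :: "nat \<Rightarrow> real"
  cnum :: nat
  cnode :: "nat \<Rightarrow> real \<times> real"
  cwt :: "nat \<Rightarrow> real"
  cwx :: real
  cwy :: real

text \<open>The Gauss rule is the \<open>N\<close>-point rule of degree of exactness \<open>2 N - 1\<close>.\<close>

definition gauss_rule :: "nat \<Rightarrow> quadrature \<Rightarrow> bool" where
  "gauss_rule N q \<longleftrightarrow> gnum q = N \<and> inj_on (gnode q) {..<N} \<and>
    (\<forall>\<mu><N. -1/2 < gnode q \<mu> \<and> gnode q \<mu> < 1/2 \<and> gwt q \<mu> > 0) \<and>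
    (\<Sum>\<mu><N. gwt q \<mu>) = 1 \<and>
    (\<forall>r::real poly. degree r \<le> 2 * N - 1 \<longrightarrow>
       (\<Sum>\<mu><N. gwt q \<mu> * poly r (gnode q \<mu>)) = integral {-1/2..1/2} (poly r))"

definition cad_sum :: "quadrature \<Rightarrow> (real \<times> real \<Rightarrow> 'a::real_vector) \<Rightarrow> 'a" where
  "cad_sum q f =
    (\<Sum>s<cnum q. cwt q s *\<^sub>R f (cnode q s)) +
    (\<Sum>\<mu><gnum q. (cwx q * gwt q \<mu>) *\<^sub>R (f (-1/2, gnode q \<mu>) + f (1/2, gnode q \<mu>))) +
    (\<Sum>\<mu><gnum q. (cwy q * gwt q \<mu>) *\<^sub>R (f (gnode q \<mu>, -1/2) + f (gnode q \<mu>, 1/2)))"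

definition cad_rule :: "nat \<Rightarrow> quadrature \<Rightarrow> bool" where
  "cad_rule k q \<longleftrightarrow>
    (\<forall>s<cnum q. cnode q s \<in> box (-1/2, -1/2) (1/2, 1/2) \<and> cwt q s > 0) \<and>
    2 * cwx q + 2 * cwy q + (\<Sum>s<cnum q. cwt q s) = 1 \<and>
    (\<forall>f::real \<times> real \<Rightarrow> real. poly2 k f \<longrightarrow>
       cad_sum q f = integral (cbox (-1/2, -1/2) (1/2, 1/2)) f)"

text \<open>The constant of the Cui--Ding--Wu CAD.  For \<open>k \<ge> 6\<close> it is not given by a
  formula here but by the parameter \<open>lit\<close>.\<close>

definition omega_star :: "(nat \<Rightarrow> real \<Rightarrow> real) \<Rightarrow> nat \<Rightarrow> real \<Rightarrow> real" where
  "omega_star lit k z =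
    (if k = 1 then 1/2
     else if k \<in> {2, 3} then 1 / (4 + 2 * \<bar>z\<bar>)
     else if k \<in> {4, 5} then
       inverse (14/3 + 2/3 * sqrt (78 * z\<^sup>2 + 46) *
         cos (1/3 * arccos ((1476 * z\<^sup>2 - 244) / (78 * z\<^sup>2 + 46) powr (3/2))))
     else lit k z)"

definition zeta :: "grid \<Rightarrow> real \<Rightarrow> real \<Rightarrow> real" where
  "zeta g a1 a2 = (a1 / dx g - a2 / dy g) / (a1 / dx g + a2 / dy g)"

definition improved_cad :: "nat \<Rightarrow> grid \<Rightarrow> real \<Rightarrow> real \<Rightarrow> real \<Rightarrow> quadrature \<Rightarrow> bool" where
  "improved_cad k g a1 a2 om q \<longleftrightarrow> cad_rule k q \<and>
    cwx q = (om * a1 / dx g) / (a1 / dx g + a2 / dy g) \<and>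
    cwy q = (om * a2 / dy g) / (a1 / dx g + a2 / dy g)"


section \<open>Discrete data\<close>

text \<open>\<open>R = (\<rho>, m, B\<^sub>3, E)\<close> and \<open>Q = (B\<^sub>1, B\<^sub>2)\<close>.\<close>

type_synonym rvec = "real \<times> (real^3) \<times> real \<times> real"

definition join :: "rvec \<Rightarrow> real^2 \<Rightarrow> state" where
  "join R Q = (case R of (r, m, B3, E) \<Rightarrow> (r, m, vector [Q $ 1, Q $ 2, B3], E))"

text \<open>\<open>Rh sh c\<close> and \<open>Qh sh c\<close> are the polynomials (as functions on the whole plane) of the cell
  \<open>c\<close> of mesh \<open>sh\<close>; \<open>Qbar sh c\<close> is the auxiliary average, independent of \<open>Qh\<close>.\<close>

record solution =
  Rh :: "mesh \<Rightarrow> cell \<Rightarrow> real \<times> real \<Rightarrow> rvec"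
  Qh :: "mesh \<Rightarrow> cell \<Rightarrow> real \<times> real \<Rightarrow> real^2"
  Qbar :: "mesh \<Rightarrow> cell \<Rightarrow> real^2"

definition Uh :: "solution \<Rightarrow> mesh \<Rightarrow> cell \<Rightarrow> real \<times> real \<Rightarrow> state" where
  "Uh w sh c z = join (Rh w sh c z) (Qh w sh c z)"

definition Rbar :: "grid \<Rightarrow> solution \<Rightarrow> mesh \<Rightarrow> cell \<Rightarrow> rvec" where
  "Rbar g w sh c = (1 / (dx g * dy g)) *\<^sub>R integral (cell_box g sh c) (Rh w sh c)"

definition Ubar :: "grid \<Rightarrow> solution \<Rightarrow> mesh \<Rightarrow> cell \<Rightarrow> state" where
  "Ubar g w sh c = join (Rbar g w sh c) (Qbar w sh c)"

definition divergence_free_on :: "(real \<times> real) set \<Rightarrow> (real \<times> real \<Rightarrow> real^2) \<Rightarrow> bool" where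
  "divergence_free_on S Q \<longleftrightarrow>
    (\<forall>(x, y) \<in> S. deriv (\<lambda>t. Q (t, y) $ 1) x + deriv (\<lambda>t. Q (x, t) $ 2) y = 0)"

definition globally_divergence_free :: "grid \<Rightarrow> solution \<Rightarrow> bool" where
  "globally_divergence_free g w \<longleftrightarrow> (\<forall>sh.
    (\<forall>c \<in> cells g sh. divergence_free_on (interior (cell_box g sh c)) (Qh w sh c)) \<and>
    (\<forall>i j. (i, j) \<in> cells g sh \<and> (i + 1, j) \<in> cells g sh \<longrightarrow>
       (\<forall>z \<in> cell_box g sh (i, j) \<inter> cell_box g sh (i + 1, j).
          Qh w sh (i, j) z $ 1 = Qh w sh (i + 1, j) z $ 1)) \<and>
    (\<forall>i j. (i, j) \<in> cells g sh \<and> (i, j + 1) \<in> cells g sh \<longrightarrow>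
       (\<forall>z \<in> cell_box g sh (i, j) \<inter> cell_box g sh (i, j + 1).
          Qh w sh (i, j) z $ 2 = Qh w sh (i, j + 1) z $ 2)))"

definition cdg_data :: "nat \<Rightarrow> grid \<Rightarrow> solution \<Rightarrow> bool" where
  "cdg_data k g w \<longleftrightarrow>
    (\<forall>sh. \<forall>c \<in> cells g sh.
       poly2 k (Rh w sh c) \<and> poly2 (k + 1) (Qh w sh c) \<and> Ubar g w sh c \<in> Gset) \<and>
    globally_divergence_free g w"


section \<open>Positivity-preserving limiter\<close>

text \<open>Throughout, \<open>X\<close> is the finite set of limiter points of a cell, \<open>U\<close> the polynomial state of
  that cell and \<open>Ub\<close> its full cell average.  \<open>scaling\<close> returns \<open>1\<close> if no limiting is needed,
  i.e. if the minimum is at least \<open>\<epsilon>\<close>; otherwise the quotient has a positive denominator.\<close>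

definition scaling :: "real \<Rightarrow> real \<Rightarrow> real" where
  "scaling avg mn =
    (let eps = min (1 / 10 ^ 13) avg
     in if eps \<le> mn then 1 else min ((avg - eps) / (avg - mn)) 1)"

definition U_check :: "(real \<times> real) set \<Rightarrow> (real \<times> real \<Rightarrow> state) \<Rightarrow> state \<Rightarrow> real \<times> real \<Rightarrow> state" where
  "U_check X U Ub z =
    (let th = scaling (rho Ub) (Min ((\<lambda>z. rho (U z)) ` X))
     in ((1 - th) * rho Ub + th * rho (U z), mom (U z), mag (U z), energy (U z)))"

definition U_hat :: "(real \<times> real) set \<Rightarrow> (real \<times> real \<Rightarrow> state) \<Rightarrow> state \<Rightarrow> real \<times> real \<Rightarrow> state" where
  "U_hat X U Ub z =
    (let th = scaling (Eint Ub) (Min ((\<lambda>z. Eint (U_check X U Ub z)) ` X))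
     in (1 - th) *\<^sub>R Ub + th *\<^sub>R U_check X U Ub z)"

definition U_tilde :: "(real \<times> real) set \<Rightarrow> (real \<times> real \<Rightarrow> state) \<Rightarrow> state \<Rightarrow> real \<times> real \<Rightarrow> state" where
  "U_tilde X U Ub z =
    (let H = U_hat X U Ub z
     in conserved (rho H) (vel H) (vector [mag (U z) $ 1, mag (U z) $ 2, mag H $ 3]) (sie H))"

definition gnodes :: "quadrature \<Rightarrow> real set" where
  "gnodes q = gnode q ` {..<gnum q}"

definition ref_points :: "quadrature \<Rightarrow> (real \<times> real) set" where
  "ref_points q =
    cnode q ` {..<cnum q} \<union> {-1/2, 1/2} \<times> gnodes q \<union> gnodes q \<times> {-1/2, 1/2} \<union>
    gnodes q \<times> gnodes q \<union> {-1/2, 1/2} \<times> {-1/2, 1/2}"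

definition lim_points :: "grid \<Rightarrow> quadrature \<Rightarrow> mesh \<Rightarrow> cell \<Rightarrow> (real \<times> real) set" where
  "lim_points g q sh c = (\<Union>s \<in> {-1, 1}. \<Union>t \<in> {-1, 1}. qpoint g sh c s t ` ref_points q)"

definition limited :: "grid \<Rightarrow> quadrature \<Rightarrow> solution \<Rightarrow> mesh \<Rightarrow> cell \<Rightarrow> real \<times> real \<Rightarrow> state" where
  "limited g q w sh c = U_tilde (lim_points g q sh c) (Uh w sh c) (Ubar g w sh c)"


section \<open>Forward Euler update of the cell averages\<close>

text \<open>Limited value of the other mesh on the quarter \<open>K\<^bsub>s,t\<^esub>\<close> of the cell \<open>c\<close> of mesh \<open>sh\<close>, at the
  point with reference coordinates \<open>z\<close>.\<close>

definition qval :: "grid \<Rightarrow> quadrature \<Rightarrow> solution \<Rightarrow> mesh \<Rightarrow> cell \<Rightarrow> int \<Rightarrow> int \<Rightarrow> real \<times> real \<Rightarrow> state" where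
  "qval g q w sh c s t z = limited g q w (other sh) (nbr sh s t c) (qpoint g sh c s t z)"

text \<open>Values at the Gauss nodes of the right/left (\<open>s = \<plusminus>1\<close>) edge halves of the cell \<open>c\<close>, and of its
  top/bottom (\<open>t = \<plusminus>1\<close>) edge halves.  For the primal cell \<open>(i,j)\<close> the state
  \<open>edge_x g q w Primal (i,j) s t \<mu>\<close> is the mesh-D value at
  \<open>(x\<^bsub>i + s/2\<^esub>, y\<^sup>(\<^sup>\<mu>\<^sup>)\<^bsub>j + t/4\<^esub>)\<close>.\<close>

definition edge_x :: "grid \<Rightarrow> quadrature \<Rightarrow> solution \<Rightarrow> mesh \<Rightarrow> cell \<Rightarrow> int \<Rightarrow> int \<Rightarrow> nat \<Rightarrow> state" where
  "edge_x g q w sh c s t \<mu> = qval g q w sh c s t (of_int s / 2, gnode q \<mu>)"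

definition edge_y :: "grid \<Rightarrow> quadrature \<Rightarrow> solution \<Rightarrow> mesh \<Rightarrow> cell \<Rightarrow> int \<Rightarrow> int \<Rightarrow> nat \<Rightarrow> state" where
  "edge_y g q w sh c s t \<mu> = qval g q w sh c s t (gnode q \<mu>, of_int t / 2)"

definition speeds_x :: "(real \<Rightarrow> real \<Rightarrow> real) \<Rightarrow> grid \<Rightarrow> quadrature \<Rightarrow> solution \<Rightarrow> real set" where
  "speeds_x p g q w =
    {alpha p 1 (edge_x g q w sh c 1 t \<mu>) (edge_x g q w sh c (-1) t \<mu>) | sh c t \<mu>.
       c \<in> active g sh \<and> t \<in> {-1, 1} \<and> \<mu> < gnum q}"

definition speeds_y :: "(real \<Rightarrow> real \<Rightarrow> real) \<Rightarrow> grid \<Rightarrow> quadrature \<Rightarrow> solution \<Rightarrow> real set" where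
  "speeds_y p g q w =
    {alpha p 2 (edge_y g q w sh c s 1 \<mu>) (edge_y g q w sh c s (-1) \<mu>) | sh c s \<mu>.
       c \<in> active g sh \<and> s \<in> {-1, 1} \<and> \<mu> < gnum q}"

definition is_max :: "real \<Rightarrow> real set \<Rightarrow> bool" where
  "is_max a S \<longleftrightarrow> a \<in> S \<and> (\<forall>b \<in> S. b \<le> a)"

definition PiD :: "grid \<Rightarrow> quadrature \<Rightarrow> solution \<Rightarrow> mesh \<Rightarrow> cell \<Rightarrow> state" where
  "PiD g q w sh c =
    (1/4) *\<^sub>R (\<Sum>s \<in> {-1, 1}. \<Sum>t \<in> {-1, 1}. cad_sum q (qval g q w sh c s t))"

definition PiF :: "(real \<Rightarrow> real \<Rightarrow> real) \<Rightarrow> grid \<Rightarrow> quadrature \<Rightarrow> solution \<Rightarrow> mesh \<Rightarrow> cell \<Rightarrow> state" where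
  "PiF p g q w sh c =
    - ((1 / dx g) *\<^sub>R (\<Sum>t \<in> {-1, 1}. \<Sum>\<mu><gnum q. (gwt q \<mu> / 2) *\<^sub>R
          (flux p 1 (edge_x g q w sh c 1 t \<mu>) - flux p 1 (edge_x g q w sh c (-1) t \<mu>))))
    - (1 / dy g) *\<^sub>R (\<Sum>s \<in> {-1, 1}. \<Sum>\<mu><gnum q. (gwt q \<mu> / 2) *\<^sub>R
          (flux p 2 (edge_y g q w sh c s 1 \<mu>) - flux p 2 (edge_y g q w sh c s (-1) \<mu>)))"

definition U_next ::
  "(real \<Rightarrow> real \<Rightarrow> real) \<Rightarrow> grid \<Rightarrow> quadrature \<Rightarrow> solution \<Rightarrow> real \<Rightarrow> real \<Rightarrow> mesh \<Rightarrow> cell \<Rightarrow> state" where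
  "U_next p g q w dt th sh c =
    (1 - th) *\<^sub>R Ubar g w sh c + th *\<^sub>R PiD g q w sh c + dt *\<^sub>R PiF p g q w sh c"

end

(* The admissible set is cut out by affine functionals: the density, and for each (us, Bs) the map
   chi us Bs U = U . n* + |Bs|^2/2, which is positive on G because it equals the internal energy plus
   the kinetic and magnetic energy relative to (us, Bs).  The heart of the argument is the inequality
     (F_l(U) - F_l(V)) . n*  <=  alpha_l(U, V) (chi U + chi V) + (B_l - B'_l) (us . Bs),
   with B, B' the magnetic fields of U, V.  Paired over opposite outer edges of a cell, the first term
   is absorbed under the CFL condition by the outer edge nodes of the CAD quadrature; the inner edge
   nodes of the quarters remain and give strict positivity.  The second terms add up to a multiple of
   the discrete divergence of the normal magnetic field over the cell boundary, which vanishes because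
   the field is globally divergence-free and the Gauss rule is exact on it. *)

theory Submission
  imports Defs
begin

section \<open>Energy functionals and flux estimates\<close>

definition chi :: "real^3 \<Rightarrow> real^3 \<Rightarrow> state \<Rightarrow> real" where
  "chi us Bs U = U \<bullet> nstar us Bs + 1/2 * (norm Bs)\<^sup>2"

lemma mom_eq_rho_vel: "rho U > 0 \<Longrightarrow> mom U = rho U *\<^sub>R vel U"
  by (simp add: vel_def)

text \<open>Completing squares in the velocity and in the magnetic field. Both squares vanish at
  \<open>us = vel U\<close>, \<open>Bs = mag U\<close>, so for positive density
  \<open>Eint U\<close> is the minimum of \<open>chi us Bs U\<close> over \<open>us\<close> and
  \<open>Bs\<close>; the concavity of \<open>Eint\<close> rests on this.\<close>

lemma chi_eq:
  assumes "rho U > 0"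
  shows "chi us Bs U = 1/2 * rho U * (norm (vel U - us))\<^sup>2 + 1/2 * (norm (mag U - Bs))\<^sup>2 + Eint U"
proof -
  obtain r m B E where U: "U = (r, m, B, E)" by (cases U) auto
  define u where "u = vel U"
  have r: "r > 0" and m: "m = r *\<^sub>R u"
    using assms mom_eq_rho_vel[OF assms] by (simp_all add: U u_def rho_def mom_def)
  have "(norm m)\<^sup>2 / r = r * (u \<bullet> u)"
    using r by (simp add: m power_mult_distrib power2_norm_eq_inner) (simp add: power2_eq_square)
  then show ?thesis
    unfolding u_def[symmetric]
    by (simp add: U chi_def nstar_def Eint_def rho_def mom_def mag_def energy_def)
       (simp add: m power2_norm_eq_inner algebra_simps inner_commute add_divide_distrib diff_divide_distrib)
qed

lemma chi_pos: "U \<in> Gset \<Longrightarrow> chi us Bs U > 0"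
  by (simp add: Gset_def chi_eq add_nonneg_pos)

text \<open>The terms are grouped by how they are estimated later. Kinetic and internal energy
  travel with \<open>vel U $ l\<close>, the relative magnetic energy with \<open>us $ l\<close>, and
  the bracket is controlled by the fast speed. The term with \<open>us \<bullet> Bs\<close> is left
  to the discrete divergence; the last term cancels in flux differences.\<close>

lemma flux_nstar:
  fixes l :: 3 and us Bs :: "real^3"
  assumes "rho U > 0"
  defines "v \<equiv> vel U - us" and "b \<equiv> mag U - Bs"
  shows "flux p l U \<bullet> nstar us Bs =
    vel U $ l * (1/2 * rho U * (norm v)\<^sup>2 + Eint U) + 1/2 * us $ l * (norm b)\<^sup>2
    + (p (rho U) (sie U) * v $ l + (b \<bullet> mag U) * v $ l - mag U $ l * (v \<bullet> b))
    + mag U $ l * (us \<bullet> Bs) - 1/2 * us $ l * (norm Bs)\<^sup>2"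
proof -
  obtain r m B E where U: "U = (r, m, B, E)" by (cases U) auto
  define u where "u = vel U"
  define P where "P = p (rho U) (sie U)"
  have r: "r > 0" and m: "m = r *\<^sub>R u"
    using assms mom_eq_rho_vel[of U] by (simp_all add: U u_def rho_def mom_def)
  have "(norm m)\<^sup>2 / r = r * (u \<bullet> u)"
    using r by (simp add: m power_mult_distrib power2_norm_eq_inner) (simp add: power2_eq_square)
  then have *: "Eint U = E - 1/2 * (r * (u \<bullet> u) + B \<bullet> B)"
    by (simp add: U Eint_def rho_def mom_def mag_def energy_def power2_norm_eq_inner)
  have F: "flux p l U \<bullet> nstar us Bs = r * u $ l * (us \<bullet> us) / 2
      - (r * u $ l * (u \<bullet> us) - B $ l * (B \<bullet> us) + (P + 1/2 * (B \<bullet> B)) * us $ l)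
      - (u $ l * (B \<bullet> Bs) - B $ l * (u \<bullet> Bs))
      + u $ l * (E + (P + 1/2 * (B \<bullet> B))) - B $ l * (u \<bullet> B)"
    unfolding flux_def ptot_def u_def[symmetric] P_def[symmetric]
    by (simp add: U nstar_def rho_def mom_def mag_def energy_def)
       (simp add: m inner_add_right inner_diff_right inner_axis power2_norm_eq_inner inner_commute)
  have v: "(norm v)\<^sup>2 = u \<bullet> u - 2 * (u \<bullet> us) + us \<bullet> us" "v $ l = u $ l - us $ l"
    by (simp_all add: v_def u_def power2_norm_eq_inner inner_diff_left inner_diff_right inner_commute)
  have b: "(norm b)\<^sup>2 = B \<bullet> B - 2 * (B \<bullet> Bs) + Bs \<bullet> Bs" "b \<bullet> mag U = B \<bullet> B - B \<bullet> Bs"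
    "v \<bullet> b = u \<bullet> B - B \<bullet> us - u \<bullet> Bs + us \<bullet> Bs"
    by (simp_all add: v_def b_def u_def U mag_def power2_norm_eq_inner inner_diff_left
        inner_diff_right inner_commute)
  have "rho U = r" "mag U = B" by (simp_all add: U rho_def mag_def)
  show ?thesis
    unfolding P_def[symmetric] F v b * u_def[symmetric]
    unfolding power2_norm_eq_inner \<open>rho U = r\<close> \<open>mag U = B\<close>
    by (simp add: algebra_simps add_divide_distrib diff_divide_distrib)
qed

section \<open>Bounds by the fast magnetosonic speed\<close>

lemma component_square_le:
  fixes x :: "real^'n"
  shows "(x $ l)\<^sup>2 \<le> (norm x)\<^sup>2"
  using component_le_norm_cart[of x l] abs_le_square_iff[of "x $ l" "norm x"] by simp

text \<open>This is the Cauchy-Schwarz inequality for the projections of \<open>x\<close> and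
  \<open>y\<close> orthogonal to the \<open>l\<close>-th axis.\<close>

lemma Cauchy_Schwarz_off_component:
  fixes x y :: "real^3"
  shows "(x \<bullet> y - x $ l * y $ l)\<^sup>2 \<le> ((norm x)\<^sup>2 - (x $ l)\<^sup>2) * ((norm y)\<^sup>2 - (y $ l)\<^sup>2)"
proof -
  define x' where "x' = x - (x $ l) *\<^sub>R axis l 1"
  define y' where "y' = y - (y $ l) *\<^sub>R axis l 1"
  have "(x' \<bullet> y')\<^sup>2 \<le> (x' \<bullet> x') * (y' \<bullet> y')"
    by (rule Cauchy_Schwarz_ineq)
  moreover have "x' \<bullet> y' = x \<bullet> y - x $ l * y $ l"
    "x' \<bullet> x' = x \<bullet> x - (x $ l)\<^sup>2" "y' \<bullet> y' = y \<bullet> y - (y $ l)\<^sup>2"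
    by (simp_all add: x'_def y'_def inner_diff_left inner_diff_right inner_axis inner_axis' power2_eq_square)
  ultimately show ?thesis by (simp add: power2_norm_eq_inner)
qed

text \<open>The number \<open>C\<^sup>2\<close> is the larger root \<open>\<mu>\<close> of \<open>\<mu>\<^sup>2 - a * \<mu> + cs\<^sup>2 * (\<beta> $ l)\<^sup>2 = 0\<close>, the squared operator
  norm of \<open>X \<mapsto> (cs * X $ l, X $ l *\<^sub>R \<beta> - \<beta> $ l *\<^sub>R X)\<close>.\<close>

lemma fast_speed_bilinear_bound:
  fixes \<beta> X b :: "real^3" and cs y :: real and l :: 3
  defines "a \<equiv> cs\<^sup>2 + (norm \<beta>)\<^sup>2"
  defines "C \<equiv> 1 / sqrt 2 * sqrt (a + sqrt (a\<^sup>2 - 4 * cs\<^sup>2 * (\<beta> $ l)\<^sup>2))"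
  shows "\<bar>cs * y * X $ l + b \<bullet> (X $ l *\<^sub>R \<beta> - \<beta> $ l *\<^sub>R X)\<bar>
    \<le> C * (1/2 * (y\<^sup>2 + (norm X)\<^sup>2 + (norm b)\<^sup>2))"
proof -
  define d where "d = sqrt (a\<^sup>2 - 4 * cs\<^sup>2 * (\<beta> $ l)\<^sup>2)"
  define \<mu> where "\<mu> = (a + d) / 2"
  \<comment> \<open>\<open>n\<close> is the squared length of the transverse part of
    \<open>\<beta>\<close>. \<open>A\<close> and \<open>D\<close> are the longitudinal and
    transverse coefficients of the quadratic form "\<open>\<mu>\<close> times the squared norm of
    \<open>X\<close>, minus the squared norm of its image". As \<open>\<mu>\<close> is a root of the
    characteristic quadratic, this form is degenerate, which is the identity
    \<open>AD\<close>.\<close>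
  define n where "n = (norm \<beta>)\<^sup>2 - (\<beta> $ l)\<^sup>2"
  define D where "D = \<mu> - (\<beta> $ l)\<^sup>2"
  define A where "A = \<mu> - cs\<^sup>2 - n"
  have n0: "n \<ge> 0"
    using component_square_le[of \<beta> l] by (simp add: n_def)
  have a: "a = cs\<^sup>2 + n + (\<beta> $ l)\<^sup>2" by (simp add: a_def n_def)
  \<comment> \<open>The discriminant is a square plus a nonnegative term, so \<open>d\<close>
    dominates the base of that square; this makes both \<open>A\<close> and \<open>D\<close>
    nonnegative.\<close>
  have "a\<^sup>2 - 4 * cs\<^sup>2 * (\<beta> $ l)\<^sup>2 = (cs\<^sup>2 + n - (\<beta> $ l)\<^sup>2)\<^sup>2 + 4 * n * (\<beta> $ l)\<^sup>2"
    by (simp add: a power2_eq_square algebra_simps)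
  then have disc: "a\<^sup>2 - 4 * cs\<^sup>2 * (\<beta> $ l)\<^sup>2 \<ge> (cs\<^sup>2 + n - (\<beta> $ l)\<^sup>2)\<^sup>2"
    using n0 by simp
  then have "d\<^sup>2 = a\<^sup>2 - 4 * cs\<^sup>2 * (\<beta> $ l)\<^sup>2"
    unfolding d_def by (meson order_trans real_sqrt_pow2 zero_le_power2)
  then have AD: "A * D = (\<beta> $ l)\<^sup>2 * n"
    by (simp add: A_def D_def \<mu>_def a power2_eq_square field_simps)
  have "\<bar>cs\<^sup>2 + n - (\<beta> $ l)\<^sup>2\<bar> \<le> d"
    unfolding d_def real_sqrt_abs[symmetric] using disc by (rule real_sqrt_le_mono)
  then have A0: "A \<ge> 0" and D0: "D \<ge> 0"
    by (simp_all add: A_def D_def \<mu>_def a field_simps abs_le_iff)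
  have "d \<ge> 0" using \<open>\<bar>cs\<^sup>2 + n - (\<beta> $ l)\<^sup>2\<bar> \<le> d\<close> by linarith
  then have l0: "\<mu> \<ge> 0" using n0 by (simp add: \<mu>_def a)
  have C: "C = sqrt \<mu>"
    by (simp add: C_def \<mu>_def d_def real_sqrt_divide real_sqrt_mult[symmetric])
  define x where "x = X $ l"
  define z where "z = (norm X)\<^sup>2 - x\<^sup>2"
  define s where "s = \<beta> \<bullet> X - \<beta> $ l * x"
  have z0: "z \<ge> 0"
    using component_square_le[of X l] by (simp add: z_def x_def)
  have s: "s\<^sup>2 \<le> n * z"
    using Cauchy_Schwarz_off_component[of \<beta> X l] by (simp add: s_def n_def z_def x_def)
  \<comment> \<open>By the bound on \<open>s\<close> and by \<open>AD\<close>, the mixed term is at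
    most twice the geometric mean of the two diagonal terms, hence at most their sum.\<close>
  have "0 \<le> A * x\<^sup>2 + 2 * (\<beta> $ l) * x * s + D * z"
  proof -
    have "(\<beta> $ l * x * s)\<^sup>2 \<le> (A * x\<^sup>2) * (D * z)"
    proof -
      have "(\<beta> $ l * x * s)\<^sup>2 = (\<beta> $ l)\<^sup>2 * x\<^sup>2 * s\<^sup>2" by (simp add: power_mult_distrib)
      also have "\<dots> \<le> (\<beta> $ l)\<^sup>2 * x\<^sup>2 * (n * z)" by (intro mult_left_mono s) simp
      also have "\<dots> = (A * D) * x\<^sup>2 * z" by (simp add: AD)
      finally show ?thesis by (simp add: mult_ac)
    qed
    then have "\<bar>\<beta> $ l * x * s\<bar> \<le> sqrt ((A * x\<^sup>2) * (D * z))"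
      unfolding real_sqrt_abs[symmetric] by (rule real_sqrt_le_mono)
    also have "\<dots> \<le> (A * x\<^sup>2 + D * z) / 2"
      by (rule arith_geo_mean_sqrt) (simp_all add: A0 D0 z0)
    finally show ?thesis by (simp add: abs_le_iff)
  qed
  then have op: "cs\<^sup>2 * x\<^sup>2 + (norm (x *\<^sub>R \<beta> - \<beta> $ l *\<^sub>R X))\<^sup>2 \<le> \<mu> * (norm X)\<^sup>2"
  proof -
    have "(norm (x *\<^sub>R \<beta> - \<beta> $ l *\<^sub>R X))\<^sup>2 = x\<^sup>2 * (norm \<beta>)\<^sup>2 - 2 * (\<beta> $ l) * x * (\<beta> \<bullet> X) + (\<beta> $ l)\<^sup>2 * (norm X)\<^sup>2"
      unfolding power2_norm_eq_inner
      by (simp add: inner_diff_left inner_diff_right inner_commute power2_eq_square)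
    moreover have "(norm X)\<^sup>2 = z + x\<^sup>2" "(norm \<beta>)\<^sup>2 = n + (\<beta> $ l)\<^sup>2" "\<beta> \<bullet> X = s + \<beta> $ l * x"
      by (simp_all add: z_def n_def s_def)
    ultimately have "\<mu> * (norm X)\<^sup>2 - (cs\<^sup>2 * x\<^sup>2 + (norm (x *\<^sub>R \<beta> - \<beta> $ l *\<^sub>R X))\<^sup>2)
        = A * x\<^sup>2 + 2 * (\<beta> $ l) * x * s + D * z"
      by (simp only:) (simp add: A_def D_def algebra_simps power2_eq_square)
    with \<open>0 \<le> A * x\<^sup>2 + 2 * (\<beta> $ l) * x * s + D * z\<close> show ?thesis by linarith
  qed
  \<comment> \<open>The expression is the scalar product of \<open>(y, b)\<close> with the image of
    \<open>X\<close>; the operator bound \<open>op\<close> and the inequality between geometric and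
    arithmetic mean finish the estimate.\<close>
  have "\<bar>cs * y * x + b \<bullet> (x *\<^sub>R \<beta> - \<beta> $ l *\<^sub>R X)\<bar> = \<bar>(y, b) \<bullet> (cs * x, x *\<^sub>R \<beta> - \<beta> $ l *\<^sub>R X)\<bar>"
    by (simp add: mult_ac)
  also have "\<dots> \<le> norm (y, b) * norm (cs * x, x *\<^sub>R \<beta> - \<beta> $ l *\<^sub>R X)"
    by (rule Cauchy_Schwarz_ineq2)
  also have "\<dots> \<le> norm (y, b) * (C * norm X)"
  proof (rule mult_left_mono)
    have "norm (cs * x, x *\<^sub>R \<beta> - \<beta> $ l *\<^sub>R X) = sqrt (cs\<^sup>2 * x\<^sup>2 + (norm (x *\<^sub>R \<beta> - \<beta> $ l *\<^sub>R X))\<^sup>2)"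
      by (simp add: norm_Pair power_mult_distrib)
    also have "\<dots> \<le> sqrt (\<mu> * (norm X)\<^sup>2)" using op by (rule real_sqrt_le_mono)
    finally show "norm (cs * x, x *\<^sub>R \<beta> - \<beta> $ l *\<^sub>R X) \<le> C * norm X"
      by (simp add: C real_sqrt_mult)
  qed simp
  also have "\<dots> = C * (norm (y, b) * norm X)" by simp
  also have "\<dots> \<le> C * (1/2 * ((norm (y, b))\<^sup>2 + (norm X)\<^sup>2))"
  proof (rule mult_left_mono)
    show "norm (y, b) * norm X \<le> 1/2 * ((norm (y, b))\<^sup>2 + (norm X)\<^sup>2)"
      using sum_squares_bound[of "norm (y, b)" "norm X"] by simp
  qed (simp add: C l0)
  finally show ?thesis by (simp add: x_def norm_Pair algebra_simps)
qed

lemma Eint_eq_sie: "rho U > 0 \<Longrightarrow> Eint U = rho U * sie U"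
  by (simp add: sie_def)

text \<open>Scaling by \<open>sqrt (rho U)\<close> reduces this to the bilinear bound:
  \<open>\<beta>\<close> is the field over \<open>sqrt (rho U)\<close>, \<open>X\<close> the scaled
  relative velocity, and \<open>y\<close> the root of twice the internal energy. Then
  \<open>chi\<close> is half the sum of the three squared norms, and the pressure term becomes
  \<open>Cs p U * y * X $ l\<close>.\<close>

lemma fast_speed_bound:
  fixes us Bs :: "real^3"
  assumes "is_eos p" "U \<in> Gset"
  defines "v \<equiv> vel U - us" and "b \<equiv> mag U - Bs"
  shows "\<bar>p (rho U) (sie U) * v $ l + (b \<bullet> mag U) * v $ l - mag U $ l * (v \<bullet> b)\<bar>
    \<le> Cfast p l U * chi us Bs U"
proof -
  define r where "r = rho U"
  define e where "e = sie U"
  define q where "q = sqrt r"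
  have r: "r > 0" and e: "e > 0"
    using assms by (auto simp: r_def e_def Gset_def sie_def)
  have q: "q > 0" "q\<^sup>2 = r" "q * q = r" using r by (simp_all add: q_def)
  define \<beta> where "\<beta> = (1 / q) *\<^sub>R mag U"
  define X where "X = q *\<^sub>R v"
  define y where "y = q * sqrt (2 * e)"
  have C: "Cfast p l U = 1 / sqrt 2 * sqrt (((Cs p U)\<^sup>2 + (norm \<beta>)\<^sup>2)
      + sqrt (((Cs p U)\<^sup>2 + (norm \<beta>)\<^sup>2)\<^sup>2 - 4 * (Cs p U)\<^sup>2 * (\<beta> $ l)\<^sup>2))"
    using q by (simp add: Cfast_def Let_def \<beta>_def r_def[symmetric] power_divide)
  have "p (rho U) (sie U) * v $ l = Cs p U * y * X $ l"
    using q(1) e by (simp add: Cs_def r_def[symmetric] e_def[symmetric] y_def X_def flip: q(3))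
  moreover have "(b \<bullet> mag U) * v $ l - mag U $ l * (v \<bullet> b) = b \<bullet> (X $ l *\<^sub>R \<beta> - \<beta> $ l *\<^sub>R X)"
    using q by (simp add: X_def \<beta>_def inner_diff_right inner_commute)
  moreover have "chi us Bs U = 1/2 * (y\<^sup>2 + (norm X)\<^sup>2 + (norm b)\<^sup>2)"
    using r e q chi_eq[of U us Bs] Eint_eq_sie[of U]
    by (simp add: r_def[symmetric] e_def[symmetric] y_def X_def v_def b_def power_mult_distrib)
  ultimately show ?thesis
    using fast_speed_bilinear_bound[of "Cs p U" y X l b \<beta>]
    unfolding C add_diff_eq[symmetric] by (simp only:)
qed

lemma pressure_pos:
  assumes "is_eos p" "U \<in> Gset"
  shows "p (rho U) (sie U) > 0"
proof -
  have "rho U > 0" "sie U > 0"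
    using assms(2) by (simp_all add: Gset_def sie_def)
  with assms(1) show ?thesis unfolding is_eos_def by blast
qed

text \<open>Testing the previous bound with a relative velocity equal to the \<open>l\<close>-th
  unit vector and with zero relative field leaves the pressure alone on the left. As the pressure is
  positive, the speed cannot be nonpositive.\<close>

lemma Cfast_pos:
  assumes "is_eos p" "U \<in> Gset"
  shows "Cfast p l U > 0"
proof (rule ccontr)
  assume "\<not> Cfast p l U > 0"
  then have c: "Cfast p l U \<le> 0" by simp
  define us where "us = vel U - axis l 1"
  have "p (rho U) (sie U) \<le> Cfast p l U * chi us (mag U) U"
    using fast_speed_bound[OF assms, of us l "mag U"] by (simp add: us_def)
  also have "\<dots> \<le> 0"
    using c chi_pos[OF assms(2)] by (simp add: mult_nonpos_nonneg less_imp_le)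
  finally show False using pressure_pos[OF assms] by simp
qed

section \<open>Flux differences and the wave speed bound \<open>alpha\<close>\<close>

lemma alpha_bounds:
  fixes U V :: state and l :: 3 and p :: "real \<Rightarrow> real \<Rightarrow> real"
  defines "s \<equiv> sqrt (rho U) + sqrt (rho V)"
  defines "M \<equiv> alpha p l U V - norm (mag U - mag V) / s"
  shows "\<bar>vel U $ l\<bar> + Cfast p l U \<le> M" "\<bar>vel V $ l\<bar> + Cfast p l V \<le> M"
    "\<bar>sqrt (rho U) * vel U $ l + sqrt (rho V) * vel V $ l\<bar> / s + max (Cfast p l U) (Cfast p l V) \<le> M"
  by (simp_all add: M_def s_def alpha_def le_max_iff_disj)

text \<open>The fast speed makes the inequality strict; this later gives the positivity of the
  maximal speeds \<open>a1\<close> and \<open>a2\<close>.\<close>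

lemma vel_le_alpha:
  fixes U V :: state and l :: 3
  assumes "is_eos p" "U \<in> Gset" "V \<in> Gset"
  shows "\<bar>vel U $ l\<bar> < alpha p l U V" "\<bar>vel V $ l\<bar> < alpha p l U V"
proof -
  have "0 \<le> norm (mag U - mag V) / (sqrt (rho U) + sqrt (rho V))"
    using assms by (simp add: Gset_def)
  then show "\<bar>vel U $ l\<bar> < alpha p l U V" "\<bar>vel V $ l\<bar> < alpha p l U V"
    using alpha_bounds(1,2)[where U = U and V = V and l = l and p = p]
      Cfast_pos[OF assms(1,2), of l] Cfast_pos[OF assms(1,3), of l] by linarith+
qed

text \<open>The term \<open>us $ l * ((norm bU)\<^sup>2 - (norm bV)\<^sup>2) / 2\<close> has no bound by the energies of the two
  states separately, as \<open>us\<close> is arbitrary.  Writing \<open>us $ l\<close> as the \<open>sqrt rho\<close>-weighted mean velocity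
  \<open>c\<close> minus the weighted mean \<open>h\<close> of the relative velocities produces the two corresponding terms
  of \<open>alpha\<close>.\<close>

lemma flux_pair_nstar_bound:
  fixes U V :: state and l :: 3
  assumes "is_eos p" and U: "U \<in> Gset" and V: "V \<in> Gset"
  shows "(flux p l U - flux p l V) \<bullet> nstar us Bs
    \<le> alpha p l U V * (chi us Bs U + chi us Bs V) + (mag U $ l - mag V $ l) * (us \<bullet> Bs)"
proof -
  define s where "s = sqrt (rho U) + sqrt (rho V)"
  define M where "M = alpha p l U V - norm (mag U - mag V) / s"
  define c where "c = (sqrt (rho U) * vel U $ l + sqrt (rho V) * vel V $ l) / s"
  define bU where "bU = mag U - Bs"
  define bV where "bV = mag V - Bs"
  define wU where "wU = vel U - us"
  define wV where "wV = vel V - us"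
  define kU where "kU = 1/2 * rho U * (norm wU)\<^sup>2 + Eint U"
  define kV where "kV = 1/2 * rho V * (norm wV)\<^sup>2 + Eint V"
  define zU where "zU = p (rho U) (sie U) * wU $ l + (bU \<bullet> mag U) * wU $ l - mag U $ l * (wU \<bullet> bU)"
  define zV where "zV = p (rho V) (sie V) * wV $ l + (bV \<bullet> mag V) * wV $ l - mag V $ l * (wV \<bullet> bV)"
  have rU: "rho U > 0" "Eint U > 0" and rV: "rho V > 0" "Eint V > 0"
    using U V by (auto simp: Gset_def)
  have s: "s > 0" using rU rV by (simp add: s_def add_pos_pos)
  have kU0: "kU \<ge> 0" and kV0: "kV \<ge> 0"
    using rU rV by (simp_all add: kU_def kV_def)
  have chiU: "chi us Bs U = kU + 1/2 * (norm bU)\<^sup>2" and chiV: "chi us Bs V = kV + 1/2 * (norm bV)\<^sup>2"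
    using rU rV by (simp_all add: chi_eq kU_def kV_def wU_def wV_def bU_def bV_def)
  have zU: "\<bar>zU\<bar> \<le> Cfast p l U * (kU + 1/2 * (norm bU)\<^sup>2)"
    using fast_speed_bound[OF assms(1) U, of us l Bs] unfolding chiU zU_def wU_def bU_def .
  have zV: "\<bar>zV\<bar> \<le> Cfast p l V * (kV + 1/2 * (norm bV)\<^sup>2)"
    using fast_speed_bound[OF assms(1) V, of us l Bs] unfolding chiV zV_def wV_def bV_def .
  have M: "\<bar>vel U $ l\<bar> + Cfast p l U \<le> M" "\<bar>vel V $ l\<bar> + Cfast p l V \<le> M"
    "\<bar>c\<bar> + Cfast p l U \<le> M" "\<bar>c\<bar> + Cfast p l V \<le> M"
    using alpha_bounds[where U = U and V = V and l = l and p = p] s by (simp_all add: s_def[symmetric] M_def c_def)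

  define h where "h = (sqrt (rho U) * wU $ l + sqrt (rho V) * wV $ l) / s"
  have usl: "us $ l = c - h"
    using s by (simp add: h_def c_def wU_def wV_def field_simps) (simp add: s_def algebra_simps)
  have us: "1/2 * us $ l * ((norm bU)\<^sup>2 - (norm bV)\<^sup>2) = c * (1/2 * (norm bU)\<^sup>2) - c * (1/2 * (norm bV)\<^sup>2)
      - 1/2 * (h * ((norm bU)\<^sup>2 - (norm bV)\<^sup>2))"
    unfolding usl by (simp add: algebra_simps add_divide_distrib diff_divide_distrib)
  \<comment> \<open>The difference of squares factors into the jump of the magnetic field and the
    sum \<open>bU + bV\<close>. The product of \<open>\<bar>x + y\<bar>\<close> with the norm of
    that sum is split into squares: those of \<open>x\<close> and \<open>y\<close> are paid for by
    \<open>kU\<close> and \<open>kV\<close>, the other one by the parallelogram identity.\<close>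
  have N: "- 1/2 * (h * ((norm bU)\<^sup>2 - (norm bV)\<^sup>2))
    \<le> norm (mag U - mag V) / s * (kU + 1/2 * (norm bU)\<^sup>2 + (kV + 1/2 * (norm bV)\<^sup>2))"
  proof -
    define x where "x = sqrt (rho U) * wU $ l"
    define y where "y = sqrt (rho V) * wV $ l"
    have parallelogram: "(norm (bU + bV))\<^sup>2 + (norm (bU - bV))\<^sup>2 = 2 * (norm bU)\<^sup>2 + 2 * (norm bV)\<^sup>2"
      by (simp add: power2_norm_eq_inner inner_add_left inner_add_right inner_diff_left
          inner_diff_right inner_commute)
    have x: "x\<^sup>2 \<le> 2 * kU"
    proof -
      have "x\<^sup>2 \<le> rho U * (norm wU)\<^sup>2"
        using rU component_square_le[of wU l] by (simp add: x_def power_mult_distrib)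
      then show ?thesis using rU by (simp add: kU_def)
    qed
    have y: "y\<^sup>2 \<le> 2 * kV"
    proof -
      have "y\<^sup>2 \<le> rho V * (norm wV)\<^sup>2"
        using rV component_square_le[of wV l] by (simp add: y_def power_mult_distrib)
      then show ?thesis using rV by (simp add: kV_def)
    qed
    have "(norm bU)\<^sup>2 - (norm bV)\<^sup>2 = (bU - bV) \<bullet> (bU + bV)"
      by (simp add: power2_norm_eq_inner inner_diff_left inner_diff_right inner_add_right inner_commute)
    also have "bU - bV = mag U - mag V" by (simp add: bU_def bV_def)
    finally have "\<bar>(norm bU)\<^sup>2 - (norm bV)\<^sup>2\<bar> \<le> norm (mag U - mag V) * norm (bU + bV)"
      using Cauchy_Schwarz_ineq2 by metis
    then have "\<bar>x + y\<bar> * \<bar>(norm bU)\<^sup>2 - (norm bV)\<^sup>2\<bar> \<le> \<bar>x + y\<bar> * (norm (mag U - mag V) * norm (bU + bV))"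
      by (rule mult_left_mono) simp
    also have "\<dots> = norm (mag U - mag V) * (\<bar>x + y\<bar> * norm (bU + bV))" by simp
    also have "\<dots> \<le> norm (mag U - mag V) * (2 * kU + 2 * kV + (norm bU)\<^sup>2 + (norm bV)\<^sup>2)"
    proof (rule mult_left_mono)
      have "2 * (\<bar>x + y\<bar> * norm (bU + bV)) \<le> \<bar>x + y\<bar>\<^sup>2 + (norm (bU + bV))\<^sup>2"
        using sum_squares_bound[of "\<bar>x + y\<bar>" "norm (bU + bV)"] by simp
      also have "\<bar>x + y\<bar>\<^sup>2 \<le> 2 * x\<^sup>2 + 2 * y\<^sup>2"
        using sum_squares_bound[of x y] by (simp add: power2_sum)
      also have "(norm (bU + bV))\<^sup>2 \<le> 2 * (norm bU)\<^sup>2 + 2 * (norm bV)\<^sup>2"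
        using parallelogram zero_le_power2[of "norm (bU - bV)"] by linarith
      finally show "\<bar>x + y\<bar> * norm (bU + bV) \<le> 2 * kU + 2 * kV + (norm bU)\<^sup>2 + (norm bV)\<^sup>2"
        using x y by simp
    qed simp
    finally have *: "\<bar>(x + y) * ((norm bU)\<^sup>2 - (norm bV)\<^sup>2)\<bar>
        \<le> norm (mag U - mag V) * (2 * kU + 2 * kV + (norm bU)\<^sup>2 + (norm bV)\<^sup>2)"
      by (simp add: abs_mult)
    have "- 1/2 * ((x + y) / s * ((norm bU)\<^sup>2 - (norm bV)\<^sup>2)) = - ((x + y) * ((norm bU)\<^sup>2 - (norm bV)\<^sup>2)) / (2 * s)"
      by simp
    also have "\<dots> \<le> norm (mag U - mag V) * (2 * kU + 2 * kV + (norm bU)\<^sup>2 + (norm bV)\<^sup>2) / (2 * s)"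
      using * s by (intro divide_right_mono) linarith+
    also have "\<dots> = norm (mag U - mag V) / s * (kU + 1/2 * (norm bU)\<^sup>2 + (kV + 1/2 * (norm bV)\<^sup>2))"
      using s by (simp add: field_simps)
    finally show ?thesis by (simp add: x_def y_def h_def)
  qed

  \<comment> \<open>The bound on \<open>zU\<close> is distributed over its two energy parts. The
    kinetic and internal part is transported with \<open>vel U $ l\<close>, the magnetic part with
    \<open>c\<close>, and either speed plus the fast speed is at most \<open>M\<close>.\<close>
  have mU: "vel U $ l * kU + zU + c * (1/2 * (norm bU)\<^sup>2) \<le> M * (kU + 1/2 * (norm bU)\<^sup>2)"
  proof -
    have "(vel U $ l + Cfast p l U) * kU \<le> M * kU" "(c + Cfast p l U) * (1/2 * (norm bU)\<^sup>2) \<le> M * (1/2 * (norm bU)\<^sup>2)"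
      using M kU0 by (intro mult_right_mono; simp)+
    then show ?thesis using zU by (simp add: algebra_simps)
  qed
  have mV: "- (vel V $ l * kV) - zV - c * (1/2 * (norm bV)\<^sup>2) \<le> M * (kV + 1/2 * (norm bV)\<^sup>2)"
  proof -
    have "(- vel V $ l + Cfast p l V) * kV \<le> M * kV" "(- c + Cfast p l V) * (1/2 * (norm bV)\<^sup>2) \<le> M * (1/2 * (norm bV)\<^sup>2)"
      using M kV0 by (intro mult_right_mono; simp)+
    then show ?thesis using zV by (simp add: algebra_simps)
  qed
  have fU: "flux p l U \<bullet> nstar us Bs = vel U $ l * kU + 1/2 * us $ l * (norm bU)\<^sup>2 + zU
      + mag U $ l * (us \<bullet> Bs) - 1/2 * us $ l * (norm Bs)\<^sup>2"
    using flux_nstar[OF rU(1), of p l us Bs] unfolding zU_def wU_def bU_def kU_def .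
  have fV: "flux p l V \<bullet> nstar us Bs = vel V $ l * kV + 1/2 * us $ l * (norm bV)\<^sup>2 + zV
      + mag V $ l * (us \<bullet> Bs) - 1/2 * us $ l * (norm Bs)\<^sup>2"
    using flux_nstar[OF rV(1), of p l us Bs] unfolding zV_def wV_def bV_def kV_def .
  have "(flux p l U - flux p l V) \<bullet> nstar us Bs = (vel U $ l * kU + zU) + (- (vel V $ l * kV) - zV)
      + 1/2 * us $ l * ((norm bU)\<^sup>2 - (norm bV)\<^sup>2) + (mag U $ l - mag V $ l) * (us \<bullet> Bs)"
    unfolding inner_diff_left fU fV by (simp add: algebra_simps)
  also have "\<dots> \<le> M * (kU + 1/2 * (norm bU)\<^sup>2) + M * (kV + 1/2 * (norm bV)\<^sup>2)
      + norm (mag U - mag V) / s * (kU + 1/2 * (norm bU)\<^sup>2 + (kV + 1/2 * (norm bV)\<^sup>2))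
      + (mag U $ l - mag V $ l) * (us \<bullet> Bs)"
    unfolding us using mU mV N by linarith
  also have "\<dots> = alpha p l U V * (chi us Bs U + chi us Bs V) + (mag U $ l - mag V $ l) * (us \<bullet> Bs)"
    unfolding M_def chiU chiV by (simp add: algebra_simps)
  finally show ?thesis .
qed

text \<open>Counterpart of the previous bound for the density functional: the mass flux is density
  times velocity, so no magnetic remainder appears.\<close>

lemma flux_rho_bound:
  fixes U V :: state and l :: 3
  assumes "is_eos p" and U: "U \<in> Gset" and V: "V \<in> Gset"
  shows "rho (flux p l U - flux p l V) \<le> alpha p l U V * (rho U + rho V)"
proof -
  have r: "rho U > 0" "rho V > 0" using U V by (auto simp: Gset_def)
  have "rho (flux p l U - flux p l V) = vel U $ l * rho U - vel V $ l * rho V"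
    using r mom_eq_rho_vel[of U] mom_eq_rho_vel[of V] by (simp add: rho_def flux_def)
  also have "\<dots> \<le> alpha p l U V * rho U + alpha p l U V * rho V"
  proof -
    have "vel U $ l * rho U \<le> alpha p l U V * rho U" "- vel V $ l * rho V \<le> alpha p l U V * rho V"
      using vel_le_alpha[OF assms, of l] r by (intro mult_right_mono; simp)+
    then show ?thesis by simp
  qed
  finally show ?thesis by (simp add: algebra_simps)
qed

section \<open>Admissibility of the limited values\<close>

lemma scaling_bounds:
  assumes "avg > 0"
  shows "0 \<le> scaling avg mn" "scaling avg mn \<le> 1"
  using assms by (auto simp: scaling_def Let_def)

text \<open>Whether or not limiting takes place, the factor satisfies
  \<open>t * (avg - mn) \<le> avg - eps\<close>. So the scaled value at the minimum, and with it the
  one at any larger \<open>x\<close>, is at least \<open>eps\<close>.\<close>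

lemma scaling_pos:
  assumes avg: "avg > 0" and x: "mn \<le> x"
  shows "(1 - scaling avg mn) * avg + scaling avg mn * x > 0"
proof -
  define eps where "eps = min (1 / 10 ^ 13) avg"
  define t where "t = scaling avg mn"
  have eps: "0 < eps" "eps \<le> avg" using avg by (auto simp: eps_def)
  have t: "0 \<le> t" using scaling_bounds[OF avg] by (simp add: t_def)
  have t_eq: "t = (if eps \<le> mn then 1 else min ((avg - eps) / (avg - mn)) 1)"
    unfolding t_def scaling_def eps_def Let_def by (rule refl)
  have "t * (avg - mn) \<le> avg - eps"
  proof (cases "eps \<le> mn")
    case True
    then show ?thesis by (simp add: t_eq)
  next
    case False
    then have "t \<le> (avg - eps) / (avg - mn)" "avg - mn > 0"
      using eps by (simp_all add: t_eq)
    then show ?thesis by (simp add: pos_le_divide_eq)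
  qed
  moreover have "t * mn \<le> t * x" using t x by (simp add: mult_left_mono)
  ultimately show ?thesis using eps unfolding t_def[symmetric] by (simp add: algebra_simps)
qed

lemma rho_linear: "rho (a *\<^sub>R U + b *\<^sub>R V) = a * rho U + b * rho V"
  by (simp add: rho_def)

lemma Eint_le_chi: "rho U > 0 \<Longrightarrow> Eint U \<le> chi us Bs U"
  by (simp add: chi_eq)

lemma chi_affine:
  "chi us Bs ((1 - t) *\<^sub>R U + t *\<^sub>R V) = (1 - t) * chi us Bs U + t * chi us Bs V"
  by (simp add: chi_def inner_add_left) (simp add: algebra_simps diff_divide_distrib)

text \<open>A minimum of affine functionals is concave: \<open>chi\<close> is taken at the velocity
  and field of the combined state, where it equals \<open>Eint\<close>, while at \<open>U\<close>
  and \<open>V\<close> it is only an upper bound.\<close>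

lemma Eint_concave:
  assumes "rho U > 0" "rho V > 0" "0 \<le> t" "t \<le> 1"
  shows "(1 - t) * Eint U + t * Eint V \<le> Eint ((1 - t) *\<^sub>R U + t *\<^sub>R V)"
proof -
  define W where "W = (1 - t) *\<^sub>R U + t *\<^sub>R V"
  have "(1 - t) * Eint U \<le> (1 - t) * chi (vel W) (mag W) U" "t * Eint V \<le> t * chi (vel W) (mag W) V"
    using assms Eint_le_chi by (simp_all add: mult_left_mono)
  moreover have "chi (vel W) (mag W) W = (1 - t) * chi (vel W) (mag W) U + t * chi (vel W) (mag W) V"
    by (simp add: W_def chi_affine)
  moreover have "rho W > 0"
  proof -
    have "1 - t > 0 \<or> t > 0" by linarith
    then show ?thesis
      using assms by (auto simp: W_def rho_linear intro: add_pos_nonneg add_nonneg_pos)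
  qed
  ultimately show ?thesis using chi_eq[of W "vel W" "mag W"] by (simp add: W_def)
qed

lemma conserved_in_Gset:
  assumes "r > 0" "e > 0"
  shows "conserved r u B e \<in> Gset"
  using assms
  by (simp add: conserved_def Gset_def Eint_def rho_def mom_def mag_def energy_def power_mult_distrib)
     (simp add: power2_eq_square)

text \<open>The final replacement of the first two field components keeps density and internal
  energy, so it suffices to treat \<open>U_hat\<close>.\<close>

lemma U_tilde_in_Gset:
  assumes X: "finite X" "z \<in> X" and Ub: "Ub \<in> Gset"
  shows "U_tilde X U Ub z \<in> Gset"
proof -
  have b: "rho Ub > 0" "Eint Ub > 0" using Ub by (auto simp: Gset_def)
  have c: "rho (U_check X U Ub z) > 0"
    using scaling_pos[OF b(1) Min_le, of "(\<lambda>z. rho (U z)) ` X" "rho (U z)"] X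
    by (simp add: U_check_def Let_def rho_def)
  define t where "t = scaling (Eint Ub) (Min ((\<lambda>z. Eint (U_check X U Ub z)) ` X))"
  have t: "0 \<le> t" "t \<le> 1" using scaling_bounds[OF b(2)] by (auto simp: t_def)
  have h: "U_hat X U Ub z = (1 - t) *\<^sub>R Ub + t *\<^sub>R U_check X U Ub z"
    by (simp add: U_hat_def Let_def t_def)
  \<comment> \<open>\<open>Eint\<close> of \<open>U_check\<close> may be negative here; the scaling
    factor compensates, and concavity asks only for positive densities.\<close>
  have "0 < (1 - t) * Eint Ub + t * Eint (U_check X U Ub z)"
    unfolding t_def using X by (intro scaling_pos b Min_le) auto
  also have "\<dots> \<le> Eint (U_hat X U Ub z)"
    unfolding h by (rule Eint_concave[OF b(1) c t])
  finally have "Eint (U_hat X U Ub z) > 0" .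
  moreover have "rho (U_hat X U Ub z) > 0"
  proof -
    have "1 - t > 0 \<or> t > 0" by linarith
    then show ?thesis
      using b c t by (auto simp: h rho_linear intro: add_pos_nonneg add_nonneg_pos)
  qed
  ultimately show ?thesis
    unfolding U_tilde_def Let_def by (intro conserved_in_Gset) (simp_all add: sie_def)
qed

lemma finite_lim_points: "finite (lim_points g q sh c)"
  by (simp add: lim_points_def ref_points_def gnodes_def)

text \<open>The quarter with signs \<open>s\<close>, \<open>t\<close> is the quarter with opposite
  signs of the neighbouring cell, so its nodes are among the limiter points of that cell.\<close>

lemma qval_in_Gset:
  assumes "Ubar g w (other sh) (nbr sh s t c) \<in> Gset"
    and st: "s \<in> {-1, 1}" "t \<in> {-1, 1}" and z: "z \<in> ref_points q"
  shows "qval g q w sh c s t z \<in> Gset"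
  unfolding qval_def limited_def
proof (rule U_tilde_in_Gset[OF finite_lim_points _ assms(1)])
  have "qpoint g (other sh) (nbr sh s t c) (- s) (- t) z \<in> lim_points g q (other sh) (nbr sh s t c)"
    using st z unfolding lim_points_def by auto
  then show "qpoint g sh c s t z \<in> lim_points g q (other sh) (nbr sh s t c)"
    using qpoint_nbr[OF st] by simp
qed

text \<open>The last limiter step restores the polynomial values of these two components; thus
  limiting leaves the divergence-free structure intact.\<close>

lemma mag_qval:
  "mag (qval g q w sh c s t z) $ 1 = Qh w (other sh) (nbr sh s t c) (qpoint g sh c s t z) $ 1"
  "mag (qval g q w sh c s t z) $ 2 = Qh w (other sh) (nbr sh s t c) (qpoint g sh c s t z) $ 2"
  by (simp_all add: qval_def limited_def U_tilde_def conserved_def Let_def mag_def Uh_def join_def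
      split: prod.split)

section \<open>Discrete divergence\<close>

lemma poly2_section_1:
  fixes Q :: "real \<times> real \<Rightarrow> real^'n"
  assumes "poly2 d Q"
  shows "\<exists>r. degree r \<le> d \<and> (\<forall>x. Q (x, y) $ c = poly r x)"
proof -
  obtain a where a: "\<And>x y. Q (x, y) = (\<Sum>i\<le>d. \<Sum>j\<le>d - i. (x ^ i * y ^ j) *\<^sub>R a i j)"
    using assms unfolding poly2_def by blast
  define r where "r = (\<Sum>i\<le>d. monom (\<Sum>j\<le>d - i. y ^ j * a i j $ c) i)"
  have "degree r \<le> d"
    unfolding r_def by (rule degree_sum_le) (auto intro: order_trans[OF degree_monom_le])
  moreover have "Q (x, y) $ c = poly r x" for x
    by (simp add: a r_def poly_sum poly_monom sum_distrib_right sum_distrib_left mult_ac)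
  ultimately show ?thesis by blast
qed

lemma poly2_section_2:
  fixes Q :: "real \<times> real \<Rightarrow> real^'n"
  assumes "poly2 d Q"
  shows "\<exists>r. degree r \<le> d \<and> (\<forall>y. Q (x, y) $ c = poly r y)"
proof -
  obtain a where a: "\<And>x y. Q (x, y) = (\<Sum>i\<le>d. \<Sum>j\<le>d - i. (x ^ i * y ^ j) *\<^sub>R a i j)"
    using assms unfolding poly2_def by blast
  define r where "r = (\<Sum>i\<le>d. \<Sum>j\<le>d - i. monom (x ^ i * a i j $ c) j)"
  have "degree r \<le> d"
    unfolding r_def
    by (intro degree_sum_le) (auto intro!: degree_sum_le intro: order_trans[OF degree_monom_le])
  moreover have "Q (x, y) $ c = poly r y" for y
    by (simp add: a r_def poly_sum poly_monom mult_ac)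
  ultimately show ?thesis by blast
qed

lemma gauss_rule_pderiv:
  assumes "gauss_rule N q" and deg: "degree r \<le> 2 * N"
  shows "(\<Sum>\<mu><N. gwt q \<mu> * poly (pderiv r) (gnode q \<mu>)) = poly r (1/2) - poly r (-1/2)"
proof -
  have "degree (pderiv r) \<le> 2 * N - 1"
    using deg by (simp add: degree_pderiv)
  then have "(\<Sum>\<mu><N. gwt q \<mu> * poly (pderiv r) (gnode q \<mu>)) = integral {-1/2..1/2} (poly (pderiv r))"
    using assms(1) unfolding gauss_rule_def by blast
  moreover have "(poly (pderiv r) has_integral (poly r (1/2) - poly r (-1/2))) {-1/2..1/2}"
    by (rule fundamental_theorem_of_calculus)
       (auto simp: has_real_derivative_iff_has_vector_derivative[symmetric] intro: poly_DERIV DERIV_subset)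
  ultimately show ?thesis by (simp add: integral_unique)
qed

text \<open>The fundamental theorem of calculus on the interval of length \<open>h\<close> centred
  at \<open>X\<close>, pulled back to the reference interval, where the Gauss rule integrates the
  derivative exactly.\<close>

lemma gauss_rule_deriv:
  assumes "gauss_rule N q" and r: "degree r \<le> 2 * N" "\<And>x. f x = poly r x"
  shows "f (X + 1/2 * h) - f (X + (-1/2) * h) = h * (\<Sum>\<nu><N. gwt q \<nu> * deriv f (X + gnode q \<nu> * h))"
proof -
  define R where "R = pcompose r [:X, h:]"
  have R: "poly R x = f (X + x * h)" for x
    by (simp add: R_def poly_pcompose r)
  have "degree R \<le> 2 * N"
    using r(1) degree_pcompose_le[of r "[:X, h:]"] by (auto simp: R_def split: if_splits)
  then have "f (X + 1/2 * h) - f (X + (-1/2) * h) = (\<Sum>\<nu><N. gwt q \<nu> * poly (pderiv R) (gnode q \<nu>))"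
    using gauss_rule_pderiv[OF assms(1), of R] by (simp only: R)
  moreover have "f = poly r" using r(2) by blast
  then have "deriv f x = poly (pderiv r) x" for x
    by (simp add: DERIV_imp_deriv poly_DERIV)
  then have "poly (pderiv R) x = h * deriv f (X + x * h)" for x
    by (simp add: R_def pderiv_pcompose pderiv_pCons poly_pcompose)
  ultimately show ?thesis
    by (simp add: sum_distrib_left mult_ac)
qed

text \<open>The divergence equation is given on open cells only; this makes it available at the
  tensor product Gauss nodes.\<close>

lemma qpoint_in_interior:
  assumes st: "s \<in> {-1, 1}" "t \<in> {-1, 1}" and d: "dx g > 0" "dy g > 0"
    and z: "-1/2 < fst z" "fst z < 1/2" "-1/2 < snd z" "snd z < 1/2"
  shows "qpoint g sh c s t z \<in> interior (cell_box g sh c)"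
proof -
  have bnd: "- (d / 2) < of_int s * d / 4 + a * d / 2 \<and> of_int s * d / 4 + a * d / 2 < d / 2"
    if "s \<in> {-1, 1::int}" "d > 0" "-1/2 < a" "a < 1/2" for s and a d :: real
  proof -
    have "-1/2 * d < a * d" "a * d < 1/2 * d"
      using that by (intro mult_strict_right_mono; simp)+
    then show ?thesis using that(1) by auto
  qed
  show ?thesis
    using bnd[OF st(1) d(1) z(1,2)] bnd[OF st(2) d(2) z(3,4)]
    by (simp add: qpoint_def cell_box_def interior_cbox mem_box Basis_prod_def)
qed

text \<open>On an edge, the difference of the normal component equals the Gauss sum of its derivative across
  the quarter, so both parts of the boundary sum become sums over the same tensor product Gauss nodes.\<close>

lemma quarter_divergence:
  assumes gauss: "gauss_rule N q" and Q: "poly2 d Q" "d \<le> 2 * N"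
    and div: "divergence_free_on (interior (cell_box g sh c)) Q"
    and st: "s \<in> {-1, 1}" "t \<in> {-1, 1}" and d: "dx g > 0" "dy g > 0"
  shows "dy g * (\<Sum>\<mu><N. gwt q \<mu> * (Q (qpoint g sh c s t (1/2, gnode q \<mu>)) $ 1
        - Q (qpoint g sh c s t (-1/2, gnode q \<mu>)) $ 1))
    + dx g * (\<Sum>\<mu><N. gwt q \<mu> * (Q (qpoint g sh c s t (gnode q \<mu>, 1/2)) $ 2
        - Q (qpoint g sh c s t (gnode q \<mu>, -1/2)) $ 2)) = 0"
proof -
  define X where "X = xc g sh c + of_int s * dx g / 4"
  define Y where "Y = yc g sh c + of_int t * dy g / 4"
  define x where "x \<nu> = X + gnode q \<nu> * (dx g / 2)" for \<nu>
  define y where "y \<mu> = Y + gnode q \<mu> * (dy g / 2)" for \<mu>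
  have qp: "qpoint g sh c s t (\<xi>, \<eta>) = (X + \<xi> * (dx g / 2), Y + \<eta> * (dy g / 2))" for \<xi> \<eta>
    by (simp add: qpoint_def X_def Y_def)
  have 1: "Q (qpoint g sh c s t (1/2, gnode q \<mu>)) $ 1 - Q (qpoint g sh c s t (-1/2, gnode q \<mu>)) $ 1
      = dx g / 2 * (\<Sum>\<nu><N. gwt q \<nu> * deriv (\<lambda>u. Q (u, y \<mu>) $ 1) (x \<nu>))" for \<mu>
  proof -
    obtain r where "degree r \<le> d" "\<And>u. Q (u, y \<mu>) $ 1 = poly r u"
      using poly2_section_1[OF Q(1)] by blast
    then show ?thesis
      using gauss_rule_deriv[OF gauss, of r "\<lambda>u. Q (u, y \<mu>) $ 1" X "dx g / 2"] Q(2)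
      unfolding qp x_def y_def by simp
  qed
  have 2: "Q (qpoint g sh c s t (gnode q \<nu>, 1/2)) $ 2 - Q (qpoint g sh c s t (gnode q \<nu>, -1/2)) $ 2
      = dy g / 2 * (\<Sum>\<mu><N. gwt q \<mu> * deriv (\<lambda>u. Q (x \<nu>, u) $ 2) (y \<mu>))" for \<nu>
  proof -
    obtain r where "degree r \<le> d" "\<And>u. Q (x \<nu>, u) $ 2 = poly r u"
      using poly2_section_2[OF Q(1)] by blast
    then show ?thesis
      using gauss_rule_deriv[OF gauss, of r "\<lambda>u. Q (x \<nu>, u) $ 2" Y "dy g / 2"] Q(2)
      unfolding qp x_def y_def by simp
  qed
  have 3: "deriv (\<lambda>u. Q (u, y \<mu>) $ 1) (x \<nu>) + deriv (\<lambda>u. Q (x \<nu>, u) $ 2) (y \<mu>) = 0"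
    if "\<mu> < N" "\<nu> < N" for \<mu> \<nu>
  proof -
    have "qpoint g sh c s t (gnode q \<nu>, gnode q \<mu>) \<in> interior (cell_box g sh c)"
      by (rule qpoint_in_interior[OF st d]) (use gauss that in \<open>auto simp: gauss_rule_def\<close>)
    then show ?thesis using div by (auto simp: divergence_free_on_def qp x_def y_def)
  qed
  have "dy g * (\<Sum>\<mu><N. gwt q \<mu> * (dx g / 2 * (\<Sum>\<nu><N. gwt q \<nu> * deriv (\<lambda>u. Q (u, y \<mu>) $ 1) (x \<nu>))))
      + dx g * (\<Sum>\<nu><N. gwt q \<nu> * (dy g / 2 * (\<Sum>\<mu><N. gwt q \<mu> * deriv (\<lambda>u. Q (x \<nu>, u) $ 2) (y \<mu>))))
    = dx g * dy g / 2 * ((\<Sum>\<mu><N. \<Sum>\<nu><N. gwt q \<mu> * gwt q \<nu> * deriv (\<lambda>u. Q (u, y \<mu>) $ 1) (x \<nu>))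
      + (\<Sum>\<nu><N. \<Sum>\<mu><N. gwt q \<mu> * gwt q \<nu> * deriv (\<lambda>u. Q (x \<nu>, u) $ 2) (y \<mu>)))"
    by (simp add: sum_distrib_left algebra_simps)
  also have "(\<Sum>\<nu><N. \<Sum>\<mu><N. gwt q \<mu> * gwt q \<nu> * deriv (\<lambda>u. Q (x \<nu>, u) $ 2) (y \<mu>))
      = (\<Sum>\<mu><N. \<Sum>\<nu><N. gwt q \<mu> * gwt q \<nu> * deriv (\<lambda>u. Q (x \<nu>, u) $ 2) (y \<mu>))"
    by (rule sum.swap)
  also have "(\<Sum>\<mu><N. \<Sum>\<nu><N. gwt q \<mu> * gwt q \<nu> * deriv (\<lambda>u. Q (u, y \<mu>) $ 1) (x \<nu>)) + \<dots>
      = (\<Sum>\<mu><N. \<Sum>\<nu><N. gwt q \<mu> * gwt q \<nu> *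
          (deriv (\<lambda>u. Q (u, y \<mu>) $ 1) (x \<nu>) + deriv (\<lambda>u. Q (x \<nu>, u) $ 2) (y \<mu>)))"
    by (simp add: sum.distrib distrib_left)
  also have "\<dots> = 0"
    by (intro sum.neutral ballI) (simp add: 3)
  finally show ?thesis unfolding 1 2 by simp
qed

section \<open>Discrete divergence over a whole cell\<close>

lemma nbr_adjacent_x: "\<exists>i j. nbr sh 1 t c = (i + 1, j) \<and> nbr sh (-1) t c = (i, j)"
  by (cases sh) (auto simp: nbr_def)

lemma nbr_adjacent_y: "\<exists>i j. nbr sh s 1 c = (i, j + 1) \<and> nbr sh s (-1) c = (i, j)"
  by (cases sh) (auto simp: nbr_def)

text \<open>The identities of the four quarters are added. Contributions along the midlines of the
  cell cancel, because these lines are interfaces of the other mesh and the normal component is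
  continuous there; the outer boundary remains.\<close>

lemma discrete_divergence:
  assumes grid: "valid_grid g" and gauss: "gauss_rule N q" and d: "d \<le> 2 * N"
    and Q: "\<And>c. c \<in> cells g (other sh) \<Longrightarrow> poly2 d (Qh w (other sh) c)"
    and div: "globally_divergence_free g w" and c: "c \<in> active g sh"
  shows "(1 / dx g) * (\<Sum>t\<in>{-1, 1}. \<Sum>\<mu><N. gwt q \<mu> / 2 *
        (mag (edge_x g q w sh c 1 t \<mu>) $ 1 - mag (edge_x g q w sh c (-1) t \<mu>) $ 1))
    + (1 / dy g) * (\<Sum>s\<in>{-1, 1}. \<Sum>\<mu><N. gwt q \<mu> / 2 *
        (mag (edge_y g q w sh c s 1 \<mu>) $ 2 - mag (edge_y g q w sh c s (-1) \<mu>) $ 2)) = 0"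
proof -
  have dpos: "dx g > 0" "dy g > 0" using grid by (auto simp: valid_grid_def)
  have nb: "nbr sh s t c \<in> cells g (other sh)" if "s \<in> {-1, 1}" "t \<in> {-1, 1}" for s t
    using grid c that unfolding valid_grid_def by blast
  define F where "F s t z = Qh w (other sh) (nbr sh s t c) (qpoint g sh c s t z)" for s t z
  define A where "A s t \<xi> = (\<Sum>\<mu><N. gwt q \<mu> * F s t (\<xi>, gnode q \<mu>) $ 1)" for s t \<xi>
  define B where "B s t \<eta> = (\<Sum>\<mu><N. gwt q \<mu> * F s t (gnode q \<mu>, \<eta>) $ 2)" for s t \<eta>
  have node: "\<bar>gnode q \<mu>\<bar> \<le> 1/2" if "\<mu> < N" for \<mu>
    using gauss that by (auto simp: gauss_rule_def abs_le_iff intro: less_imp_le)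
  \<comment> \<open>Each quarter lies in a single cell of the other mesh, where it carries the signs
    \<open>- s\<close> and \<open>- t\<close>, and there the field is one polynomial.\<close>
  have quarter: "dy g * (A s t (1/2) - A s t (-1/2)) + dx g * (B s t (1/2) - B s t (-1/2)) = 0"
    if st: "s \<in> {-1, 1}" "t \<in> {-1, 1}" for s t
  proof -
    have "divergence_free_on (interior (cell_box g (other sh) (nbr sh s t c))) (Qh w (other sh) (nbr sh s t c))"
      using div nb[OF st] by (auto simp: globally_divergence_free_def)
    from quarter_divergence[OF gauss Q[OF nb[OF st]] d this, of "- s" "- t"] st dpos
    show ?thesis
      by (auto simp: qpoint_nbr[OF st] A_def B_def F_def right_diff_distrib sum_subtractf)
  qed
  \<comment> \<open>The left edge of a right quarter is the right edge of the left quarter beside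
    it, on the common interface of two horizontally adjacent cells.\<close>
  have x_interface: "F 1 t (-1/2, \<eta>) $ 1 = F (-1) t (1/2, \<eta>) $ 1"
    if t: "t \<in> {-1, 1}" and \<eta>: "\<bar>\<eta>\<bar> \<le> 1/2" for t \<eta>
  proof -
    obtain i j where ij: "nbr sh 1 t c = (i + 1, j)" "nbr sh (-1) t c = (i, j)"
      using nbr_adjacent_x by blast
    have eq: "qpoint g sh c 1 t (-1/2, \<eta>) = qpoint g sh c (-1) t (1/2, \<eta>)"
      by (simp add: qpoint_def)
    have "\<eta> \<in> {-1/2..1/2}" using abs_le_D1[OF \<eta>] abs_le_D2[OF \<eta>] by simp
    then have "qpoint g sh c 1 t (-1/2, \<eta>) \<in> cell_box g (other sh) (i + 1, j)"
      "qpoint g sh c (-1) t (1/2, \<eta>) \<in> cell_box g (other sh) (i, j)"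
      using quarter_subset_nbr[of 1 t g sh c] quarter_subset_nbr[of "-1" t g sh c] t dpos
      unfolding ij by (auto simp: cbox_Pair_eq image_subset_iff)
    then show ?thesis
      using div nb[of 1 t] nb[of "-1" t] t unfolding globally_divergence_free_def F_def ij eq
      by auto
  qed
  have y_interface: "F s 1 (\<xi>, -1/2) $ 2 = F s (-1) (\<xi>, 1/2) $ 2"
    if s: "s \<in> {-1, 1}" and \<xi>: "\<bar>\<xi>\<bar> \<le> 1/2" for s \<xi>
  proof -
    obtain i j where ij: "nbr sh s 1 c = (i, j + 1)" "nbr sh s (-1) c = (i, j)"
      using nbr_adjacent_y by blast
    have eq: "qpoint g sh c s 1 (\<xi>, -1/2) = qpoint g sh c s (-1) (\<xi>, 1/2)"
      by (simp add: qpoint_def)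
    have "\<xi> \<in> {-1/2..1/2}" using abs_le_D1[OF \<xi>] abs_le_D2[OF \<xi>] by simp
    then have "qpoint g sh c s 1 (\<xi>, -1/2) \<in> cell_box g (other sh) (i, j + 1)"
      "qpoint g sh c s (-1) (\<xi>, 1/2) \<in> cell_box g (other sh) (i, j)"
      using quarter_subset_nbr[of s 1 g sh c] quarter_subset_nbr[of s "-1" g sh c] s dpos
      unfolding ij by (auto simp: cbox_Pair_eq image_subset_iff)
    then show ?thesis
      using div nb[of s 1] nb[of s "-1"] s unfolding globally_divergence_free_def F_def ij eq
      by auto
  qed
  have AI: "A 1 t (-1/2) = A (-1) t (1/2)" if "t \<in> {-1, 1}" for t
    unfolding A_def by (rule sum.cong) (use x_interface[OF that node] in auto)
  have BI: "B s 1 (-1/2) = B s (-1) (1/2)" if "s \<in> {-1, 1}" for s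
    unfolding B_def by (rule sum.cong) (use y_interface[OF that node] in auto)
  have total: "dy g * ((A 1 1 (1/2) - A (-1) 1 (-1/2)) + (A 1 (-1) (1/2) - A (-1) (-1) (-1/2)))
      + dx g * ((B 1 1 (1/2) - B 1 (-1) (-1/2)) + (B (-1) 1 (1/2) - B (-1) (-1) (-1/2))) = 0"
    using quarter[of 1 1] quarter[of 1 "-1"] quarter[of "-1" 1] quarter[of "-1" "-1"]
      AI[of 1] AI[of "-1"] BI[of 1] BI[of "-1"]
    by (simp add: algebra_simps)
  have X: "(\<Sum>\<mu><N. gwt q \<mu> / 2 *
      (mag (edge_x g q w sh c 1 t \<mu>) $ 1 - mag (edge_x g q w sh c (-1) t \<mu>) $ 1))
    = (A 1 t (1/2) - A (-1) t (-1/2)) / 2" for t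
    by (simp add: edge_x_def mag_qval A_def F_def sum_subtractf[symmetric] sum_divide_distrib algebra_simps
        diff_divide_distrib)
  have Y: "(\<Sum>\<mu><N. gwt q \<mu> / 2 *
      (mag (edge_y g q w sh c s 1 \<mu>) $ 2 - mag (edge_y g q w sh c s (-1) \<mu>) $ 2))
    = (B s 1 (1/2) - B s (-1) (-1/2)) / 2" for s
    by (simp add: edge_y_def mag_qval B_def F_def sum_subtractf[symmetric] sum_divide_distrib algebra_simps
        diff_divide_distrib)
  show ?thesis
    unfolding X Y using total dpos by (simp add: field_simps)
qed

section \<open>Update of the cell averages\<close>

text \<open>The total weight of the quadrature is one, so constants are reproduced and an affine
  functional may be evaluated node by node.\<close>

lemma cad_sum_affine:
  fixes \<phi> :: "'a::real_vector \<Rightarrow> real"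
  assumes "linear \<phi>" and gauss: "(\<Sum>\<mu><gnum q. gwt q \<mu>) = 1"
    and wt: "2 * cwx q + 2 * cwy q + (\<Sum>s<cnum q. cwt q s) = 1"
  shows "cad_sum q (\<lambda>z. \<phi> (f z) + c) = \<phi> (cad_sum q f) + c"
proof -
  have 1: "(\<Sum>\<mu><gnum q. b * gwt q \<mu> * (x \<mu> + c + (y \<mu> + c)))
      = (\<Sum>\<mu><gnum q. b * gwt q \<mu> * (x \<mu> + y \<mu>)) + 2 * b * c" for b :: real and x y
  proof -
    have "(\<Sum>\<mu><gnum q. b * gwt q \<mu> * (x \<mu> + c + (y \<mu> + c)))
        = (\<Sum>\<mu><gnum q. b * gwt q \<mu> * (x \<mu> + y \<mu>)) + (\<Sum>\<mu><gnum q. gwt q \<mu>) * (2 * b * c)"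
      unfolding sum_distrib_right sum.distrib[symmetric] by (rule sum.cong) (simp_all add: algebra_simps)
    then show ?thesis using gauss by simp
  qed
  have 2: "(\<Sum>s<cnum q. cwt q s * (\<phi> (f (cnode q s)) + c))
      = (\<Sum>s<cnum q. cwt q s * \<phi> (f (cnode q s))) + (1 - 2 * cwx q - 2 * cwy q) * c"
  proof -
    have "(\<Sum>s<cnum q. cwt q s) = 1 - 2 * cwx q - 2 * cwy q" using wt by simp
    then show ?thesis by (simp add: distrib_left sum.distrib flip: sum_distrib_right)
  qed
  show ?thesis
    unfolding cad_sum_def real_scaleR_def 1 2
    using assms(1) by (simp add: linear_add linear_sum linear_scale o_def) (simp add: algebra_simps)
qed

text \<open>Kept are the two edges of the quarter on the boundary of the cell, where the fluxes
  live. The two inner edges have positive weights, hence the inequality is strict even without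
  internal nodes.\<close>

lemma cad_sum_gt_outer_edges:
  assumes F: "\<And>z. z \<in> ref_points q \<Longrightarrow> F z > 0"
    and st: "s \<in> {-1, 1::int}" "t \<in> {-1, 1::int}"
    and wt: "\<And>s. s < cnum q \<Longrightarrow> cwt q s > 0" "cwx q > 0" "cwy q > 0"
    and gauss: "\<And>\<mu>. \<mu> < gnum q \<Longrightarrow> gwt q \<mu> > 0" "gnum q > 0"
  shows "cwx q * (\<Sum>\<mu><gnum q. gwt q \<mu> * F (of_int s / 2, gnode q \<mu>))
    + cwy q * (\<Sum>\<mu><gnum q. gwt q \<mu> * F (gnode q \<mu>, of_int t / 2)) < cad_sum q F"
proof -
  define X where "X a = (\<Sum>\<mu><gnum q. gwt q \<mu> * F (a, gnode q \<mu>))" for a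
  define Y where "Y a = (\<Sum>\<mu><gnum q. gwt q \<mu> * F (gnode q \<mu>, a))" for a
  have pos: "X (-1/2) > 0" "X (1/2) > 0" "Y (-1/2) > 0" "Y (1/2) > 0"
    unfolding X_def Y_def using gauss
    by (auto intro!: sum_pos mult_pos_pos F simp: ref_points_def gnodes_def)
  have int: "(\<Sum>s<cnum q. cwt q s * F (cnode q s)) \<ge> 0"
    by (intro sum_nonneg mult_nonneg_nonneg less_imp_le wt F) (auto simp: ref_points_def)
  have "cad_sum q F = (\<Sum>s<cnum q. cwt q s * F (cnode q s)) + cwx q * (X (-1/2) + X (1/2)) + cwy q * (Y (-1/2) + Y (1/2))"
    by (simp add: cad_sum_def X_def Y_def sum_distrib_left distrib_left sum.distrib mult_ac)
  moreover have "cwx q * X (-1/2) > 0" "cwx q * X (1/2) > 0" "cwy q * Y (-1/2) > 0" "cwy q * Y (1/2) > 0"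
    using pos wt by simp_all
  moreover have "of_int s / 2 = (1/2 :: real) \<or> of_int s / 2 = (-1/2 :: real)"
    "of_int t / 2 = (1/2 :: real) \<or> of_int t / 2 = (-1/2 :: real)"
    using st by auto
  ultimately show ?thesis
    using int unfolding X_def[symmetric] Y_def[symmetric]
    by (elim disjE; simp only: distrib_left; linarith)
qed

lemma edge_in_ref_points:
  assumes "\<mu> < gnum q" "s \<in> {-1, 1::int}"
  shows "(of_int s / 2, gnode q \<mu>) \<in> ref_points q" "(gnode q \<mu>, of_int s / 2) \<in> ref_points q"
  using assms by (auto simp: ref_points_def gnodes_def)

text \<open>One argument serves both kinds of constraint: the density, with \<open>e\<close> and
  \<open>\<kappa>\<close> zero, and \<open>chi\<close>, with half the squared norm of
  \<open>Bs\<close> as \<open>e\<close> and \<open>us \<bullet> Bs\<close> as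
  \<open>\<kappa>\<close>.\<close>

lemma U_next_affine_pos:
  fixes \<phi> :: "state \<Rightarrow> real"
  assumes lin: "linear \<phi>"
    and pos: "\<And>U. U \<in> Gset \<Longrightarrow> \<phi> U + e > 0"
    and flux: "\<And>l U V. U \<in> Gset \<Longrightarrow> V \<in> Gset \<Longrightarrow>
      \<phi> (flux p l U - flux p l V) \<le> alpha p l U V * ((\<phi> U + e) + (\<phi> V + e)) + (mag U $ l - mag V $ l) * \<kappa>"
    and grid: "dx g > 0" "dy g > 0"
    and gauss: "gauss_rule N q" "N > 0" and cad: "cad_rule k q" "cwx q > 0" "cwy q > 0"
    and Ubar: "Ubar g w sh c \<in> Gset"
    and qval: "\<And>s t z. s \<in> {-1, 1} \<Longrightarrow> t \<in> {-1, 1} \<Longrightarrow> z \<in> ref_points q \<Longrightarrow> qval g q w sh c s t z \<in> Gset"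
    and div: "(1 / dx g) * (\<Sum>t\<in>{-1, 1}. \<Sum>\<mu><N. gwt q \<mu> / 2 *
        (mag (edge_x g q w sh c 1 t \<mu>) $ 1 - mag (edge_x g q w sh c (-1) t \<mu>) $ 1))
      + (1 / dy g) * (\<Sum>s\<in>{-1, 1}. \<Sum>\<mu><N. gwt q \<mu> / 2 *
        (mag (edge_y g q w sh c s 1 \<mu>) $ 2 - mag (edge_y g q w sh c s (-1) \<mu>) $ 2)) = 0"
    and a1: "\<And>t \<mu>. t \<in> {-1, 1} \<Longrightarrow> \<mu> < N \<Longrightarrow>
      alpha p 1 (edge_x g q w sh c 1 t \<mu>) (edge_x g q w sh c (-1) t \<mu>) \<le> a1"
    and a2: "\<And>s \<mu>. s \<in> {-1, 1} \<Longrightarrow> \<mu> < N \<Longrightarrow>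
      alpha p 2 (edge_y g q w sh c s 1 \<mu>) (edge_y g q w sh c s (-1) \<mu>) \<le> a2"
    and th: "0 < th" "th \<le> 1" and dt: "dt \<ge> 0"
    and cfl: "dt * a1 / dx g \<le> th * cwx q / 2" "dt * a2 / dy g \<le> th * cwy q / 2"
  shows "\<phi> (U_next p g q w dt th sh c) + e > 0"
proof -
  define W where "W U = \<phi> U + e" for U
  have N: "gnum q = N" "(\<Sum>\<mu><gnum q. gwt q \<mu>) = 1" "\<And>\<mu>. \<mu> < N \<Longrightarrow> gwt q \<mu> > 0"
    using gauss(1) by (auto simp: gauss_rule_def)
  define Ex where "Ex = edge_x g q w sh c"
  define Ey where "Ey = edge_y g q w sh c"
  have ExG: "Ex s t \<mu> \<in> Gset" and EyG: "Ey s t \<mu> \<in> Gset"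
    if "s \<in> {-1, 1}" "t \<in> {-1, 1}" "\<mu> < N" for s t \<mu>
    using that qval edge_in_ref_points[of \<mu> q] N(1)
    by (simp_all add: Ex_def Ey_def edge_x_def edge_y_def)
  have Wpos: "W U > 0" if "U \<in> Gset" for U
    using pos[OF that] by (simp add: W_def)
  define Sx where "Sx = (\<Sum>t\<in>{-1, 1}. \<Sum>\<mu><N. gwt q \<mu> * (W (Ex 1 t \<mu>) + W (Ex (-1) t \<mu>)))"
  define Sy where "Sy = (\<Sum>s\<in>{-1, 1}. \<Sum>\<mu><N. gwt q \<mu> * (W (Ey s 1 \<mu>) + W (Ey s (-1) \<mu>)))"
  have S0: "Sx \<ge> 0" "Sy \<ge> 0"
    unfolding Sx_def Sy_def
    by (intro sum_nonneg mult_nonneg_nonneg add_nonneg_nonneg less_imp_le N(3) Wpos ExG EyG; simp)+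

  \<comment> \<open>The factor 1/4 averages over the quarters. Each outer half edge belongs to
    exactly one quarter, so \<open>Sx\<close> and \<open>Sy\<close> collect the kept nodes once
    each.\<close>
  have D: "W (PiD g q w sh c) > 1/4 * (cwx q * Sx + cwy q * Sy)"
  proof -
    have c: "W (cad_sum q f) = cad_sum q (\<lambda>z. W (f z))" for f
      unfolding W_def using cad_sum_affine[OF lin N(2)] cad(1) by (simp add: cad_rule_def)
    have gt: "cwx q * (\<Sum>\<mu><N. gwt q \<mu> * W (Ex s t \<mu>)) + cwy q * (\<Sum>\<mu><N. gwt q \<mu> * W (Ey s t \<mu>))
        < W (cad_sum q (qval g q w sh c s t))" if st: "s \<in> {-1, 1}" "t \<in> {-1, 1}" for s t
      unfolding c Ex_def Ey_def edge_x_def edge_y_def N(1)[symmetric]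
      using cad N gauss by (intro cad_sum_gt_outer_edges Wpos qval st) (auto simp: cad_rule_def)
    have "W (PiD g q w sh c) = 1/4 * (\<Sum>s\<in>{-1, 1}. \<Sum>t\<in>{-1, 1}. W (cad_sum q (qval g q w sh c s t)))"
      using lin by (simp add: PiD_def W_def linear_add linear_scale)
    also have "\<dots> > 1/4 * (\<Sum>s\<in>{-1, 1}. \<Sum>t\<in>{-1, 1}. cwx q * (\<Sum>\<mu><N. gwt q \<mu> * W (Ex s t \<mu>)) + cwy q * (\<Sum>\<mu><N. gwt q \<mu> * W (Ey s t \<mu>)))"
      by (intro mult_strict_left_mono sum_strict_mono gt) auto
    also have "(\<Sum>s\<in>{-1, 1}. \<Sum>t\<in>{-1, 1}. cwx q * (\<Sum>\<mu><N. gwt q \<mu> * W (Ex s t \<mu>)) + cwy q * (\<Sum>\<mu><N. gwt q \<mu> * W (Ey s t \<mu>)))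
        = cwx q * Sx + cwy q * Sy"
      by (simp add: Sx_def Sy_def distrib_left sum.distrib)
    finally show ?thesis .
  qed

  have flux_x: "\<phi> (flux p 1 (Ex 1 t \<mu>) - flux p 1 (Ex (-1) t \<mu>))
      \<le> a1 * (W (Ex 1 t \<mu>) + W (Ex (-1) t \<mu>)) + (mag (Ex 1 t \<mu>) $ 1 - mag (Ex (-1) t \<mu>) $ 1) * \<kappa>"
    if t: "t \<in> {-1, 1}" and \<mu>: "\<mu> < N" for t \<mu>
  proof -
    have G: "Ex 1 t \<mu> \<in> Gset" "Ex (-1) t \<mu> \<in> Gset" using ExG t \<mu> by auto
    have "alpha p 1 (Ex 1 t \<mu>) (Ex (-1) t \<mu>) * (W (Ex 1 t \<mu>) + W (Ex (-1) t \<mu>))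
        \<le> a1 * (W (Ex 1 t \<mu>) + W (Ex (-1) t \<mu>))"
      unfolding Ex_def using Wpos[OF G(1)] Wpos[OF G(2)]
      by (intro mult_right_mono a1[OF t \<mu>]) (simp add: Ex_def)
    then show ?thesis using flux[OF G, of 1] by (simp add: W_def)
  qed
  have flux_y: "\<phi> (flux p 2 (Ey s 1 \<mu>) - flux p 2 (Ey s (-1) \<mu>))
      \<le> a2 * (W (Ey s 1 \<mu>) + W (Ey s (-1) \<mu>)) + (mag (Ey s 1 \<mu>) $ 2 - mag (Ey s (-1) \<mu>) $ 2) * \<kappa>"
    if s: "s \<in> {-1, 1}" and \<mu>: "\<mu> < N" for s \<mu>
  proof -
    have G: "Ey s 1 \<mu> \<in> Gset" "Ey s (-1) \<mu> \<in> Gset" using EyG s \<mu> by auto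
    have "alpha p 2 (Ey s 1 \<mu>) (Ey s (-1) \<mu>) * (W (Ey s 1 \<mu>) + W (Ey s (-1) \<mu>))
        \<le> a2 * (W (Ey s 1 \<mu>) + W (Ey s (-1) \<mu>))"
      unfolding Ey_def using Wpos[OF G(1)] Wpos[OF G(2)]
      by (intro mult_right_mono a2[OF s \<mu>]) (simp add: Ey_def)
    then show ?thesis using flux[OF G, of 2] by (simp add: W_def)
  qed

  define Jx where "Jx = (\<Sum>t\<in>{-1, 1}. \<Sum>\<mu><N. gwt q \<mu> / 2 * (mag (Ex 1 t \<mu>) $ 1 - mag (Ex (-1) t \<mu>) $ 1))"
  define Jy where "Jy = (\<Sum>s\<in>{-1, 1}. \<Sum>\<mu><N. gwt q \<mu> / 2 * (mag (Ey s 1 \<mu>) $ 2 - mag (Ey s (-1) \<mu>) $ 2))"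
  define Fx where "Fx = (\<Sum>t\<in>{-1, 1}. \<Sum>\<mu><N. gwt q \<mu> / 2 * \<phi> (flux p 1 (Ex 1 t \<mu>) - flux p 1 (Ex (-1) t \<mu>)))"
  define Fy where "Fy = (\<Sum>s\<in>{-1, 1}. \<Sum>\<mu><N. gwt q \<mu> / 2 * \<phi> (flux p 2 (Ey s 1 \<mu>) - flux p 2 (Ey s (-1) \<mu>)))"
  have "Fx \<le> (\<Sum>t\<in>{-1, 1}. \<Sum>\<mu><N. gwt q \<mu> / 2 * (a1 * (W (Ex 1 t \<mu>) + W (Ex (-1) t \<mu>))
      + (mag (Ex 1 t \<mu>) $ 1 - mag (Ex (-1) t \<mu>) $ 1) * \<kappa>))"
    unfolding Fx_def using N(3) by (intro sum_mono mult_left_mono flux_x) (auto intro: less_imp_le)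
  also have "\<dots> = a1 / 2 * Sx + \<kappa> * Jx"
    unfolding Sx_def Jx_def sum_distrib_left sum.distrib[symmetric]
    by (intro sum.cong refl) (simp add: algebra_simps diff_divide_distrib add_divide_distrib)
  finally have Fx: "Fx \<le> a1 / 2 * Sx + \<kappa> * Jx" .
  have "Fy \<le> (\<Sum>s\<in>{-1, 1}. \<Sum>\<mu><N. gwt q \<mu> / 2 * (a2 * (W (Ey s 1 \<mu>) + W (Ey s (-1) \<mu>))
      + (mag (Ey s 1 \<mu>) $ 2 - mag (Ey s (-1) \<mu>) $ 2) * \<kappa>))"
    unfolding Fy_def using N(3) by (intro sum_mono mult_left_mono flux_y) (auto intro: less_imp_le)
  also have "\<dots> = a2 / 2 * Sy + \<kappa> * Jy"
    unfolding Sy_def Jy_def sum_distrib_left sum.distrib[symmetric]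
    by (intro sum.cong refl) (simp add: algebra_simps diff_divide_distrib add_divide_distrib)
  finally have Fy: "Fy \<le> a2 / 2 * Sy + \<kappa> * Jy" .

  have "\<phi> (PiF p g q w sh c) = - (1 / dx g * Fx) - 1 / dy g * Fy"
    unfolding PiF_def Fx_def Fy_def Ex_def Ey_def N(1)
    by (simp only: linear_diff[OF lin] linear_neg[OF lin] linear_scale[OF lin] linear_sum[OF lin]
        real_scaleR_def)
  also have "\<dots> \<ge> - (1 / dx g * (a1 / 2 * Sx + \<kappa> * Jx)) - 1 / dy g * (a2 / 2 * Sy + \<kappa> * Jy)"
    using mult_left_mono[OF Fx, of "1 / dx g"] mult_left_mono[OF Fy, of "1 / dy g"] grid by simp
  also have "- (1 / dx g * (a1 / 2 * Sx + \<kappa> * Jx)) - 1 / dy g * (a2 / 2 * Sy + \<kappa> * Jy)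
      = - (a1 / (2 * dx g) * Sx) - a2 / (2 * dy g) * Sy - \<kappa> * (1 / dx g * Jx + 1 / dy g * Jy)"
    by (simp add: algebra_simps add_divide_distrib)
  \<comment> \<open>All magnetic remainders carry the same factor \<open>\<kappa>\<close>, so they
    combine to a multiple of the discrete divergence.\<close>
  also have "1 / dx g * Jx + 1 / dy g * Jy = 0"
    using div by (simp only: Jx_def Jy_def Ex_def Ey_def)
  finally have F: "- (a1 / (2 * dx g) * Sx) - a2 / (2 * dy g) * Sy \<le> \<phi> (PiF p g q w sh c)" by simp

  \<comment> \<open>The half weights of the half edges and the 1/4 of the quarter average match the
    factor 1/2 in the directional CFL conditions.\<close>
  have "dt * (a1 / (2 * dx g) * Sx) + dt * (a2 / (2 * dy g) * Sy) \<le> th * (1/4 * (cwx q * Sx + cwy q * Sy))"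
  proof -
    have "dt * a1 / dx g * Sx \<le> th * cwx q / 2 * Sx" "dt * a2 / dy g * Sy \<le> th * cwy q / 2 * Sy"
      by (rule mult_right_mono[OF cfl(1) S0(1)], rule mult_right_mono[OF cfl(2) S0(2)])
    moreover have "dt * (a1 / (2 * dx g) * Sx) = 1/2 * (dt * a1 / dx g * Sx)"
      "dt * (a2 / (2 * dy g) * Sy) = 1/2 * (dt * a2 / dy g * Sy)" by simp_all
    moreover have "th * (1/4 * (cwx q * Sx + cwy q * Sy)) = 1/2 * (th * cwx q / 2 * Sx) + 1/2 * (th * cwy q / 2 * Sy)"
      by (simp add: algebra_simps add_divide_distrib)
    ultimately show ?thesis by linarith
  qed
  \<comment> \<open>Strictness enters here through \<open>D\<close> and \<open>th > 0\<close>; the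
    old average contributes only a nonnegative amount, as \<open>th\<close> may be 1.\<close>
  moreover have "th * (1/4 * (cwx q * Sx + cwy q * Sy)) < th * W (PiD g q w sh c)"
    using D th(1) by (rule mult_strict_left_mono)
  moreover have "- (dt * (a1 / (2 * dx g) * Sx)) - dt * (a2 / (2 * dy g) * Sy) \<le> dt * \<phi> (PiF p g q w sh c)"
    using mult_left_mono[OF F dt] by (simp add: algebra_simps)
  moreover have "0 \<le> (1 - th) * W (Ubar g w sh c)"
    using th Wpos[OF Ubar] by simp
  moreover have "\<phi> (U_next p g q w dt th sh c) + e
      = (1 - th) * W (Ubar g w sh c) + th * W (PiD g q w sh c) + dt * \<phi> (PiF p g q w sh c)"
    unfolding U_next_def W_def using lin by (simp add: linear_add linear_scale) (simp add: algebra_simps)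
  ultimately show ?thesis by linarith
qed

section \<open>Admissibility of the updated averages on both meshes\<close>

theorem theorem3p5:
  fixes p :: "real \<Rightarrow> real \<Rightarrow> real"
    and k :: nat
    and g :: grid
    and q :: quadrature
    and w :: solution
    and lit :: "nat \<Rightarrow> real \<Rightarrow> real"
    and a1 a2 om dt tau th :: real
  assumes k: "k \<ge> 1"
    and eos: "is_eos p"
    and grid: "valid_grid g"
    and gauss: "gauss_rule (k + 1) q"
    and data: "cdg_data k g w"
    and a1: "is_max a1 (speeds_x p g q w)"
    and a2: "is_max a2 (speeds_y p g q w)"
    and om: "om = omega_star lit k (zeta g a1 a2)"
    and lit: "k \<ge> 6 \<Longrightarrow> lit k (zeta g a1 a2) > 0"
    and cad: "improved_cad k g a1 a2 om q"
    and tau: "tau > 0"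
    and th: "th = dt / tau" "0 < th" "th \<le> 1"
    and cfl: "dt * (a1 / dx g + a2 / dy g) \<le> th * om / 2"
  shows "(\<forall>c \<in> active g Primal. U_next p g q w dt th Primal c \<in> Gstar) \<and>
         (\<forall>c \<in> active g Dual. U_next p g q w dt th Dual c \<in> Gstar)"
proof -
  have d: "dx g > 0" "dy g > 0" using grid by (auto simp: valid_grid_def)
  have N: "gnum q = k + 1" using gauss by (simp add: gauss_rule_def)
  have dt: "dt > 0" using th tau by (simp add: zero_less_divide_iff)
  have Ubar: "Ubar g w sh c \<in> Gset" if "c \<in> cells g sh" for sh c
    using data that by (auto simp: cdg_data_def)
  have qval: "qval g q w sh c s t z \<in> Gset"
    if "c \<in> active g sh" "s \<in> {-1, 1}" "t \<in> {-1, 1}" "z \<in> ref_points q" for sh c s t z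
    using that grid unfolding valid_grid_def by (intro qval_in_Gset Ubar) blast+
  have Gx: "edge_x g q w sh c s t \<mu> \<in> Gset" and Gy: "edge_y g q w sh c s t \<mu> \<in> Gset"
    if "c \<in> active g sh" "s \<in> {-1, 1}" "t \<in> {-1, 1}" "\<mu> < gnum q" for sh c s t \<mu>
    using that by (auto simp: edge_x_def edge_y_def simp del: of_int_minus intro!: qval edge_in_ref_points)
  \<comment> \<open>The maximum is attained, and every \<open>alpha\<close> of admissible states
    strictly exceeds an absolute value.\<close>
  have a1_pos: "a1 > 0"
  proof -
    obtain sh c t \<mu> where *: "a1 = alpha p 1 (edge_x g q w sh c 1 t \<mu>) (edge_x g q w sh c (-1) t \<mu>)"
      "c \<in> active g sh" "t \<in> {-1, 1}" "\<mu> < gnum q"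
      using a1 unfolding is_max_def speeds_x_def by blast
    then have "edge_x g q w sh c 1 t \<mu> \<in> Gset" "edge_x g q w sh c (-1) t \<mu> \<in> Gset"
      by (auto intro: Gx)
    from vel_le_alpha(1)[OF eos this, of 1] show ?thesis unfolding *(1) by linarith
  qed
  have a2_pos: "a2 > 0"
  proof -
    obtain sh c s \<mu> where *: "a2 = alpha p 2 (edge_y g q w sh c s 1 \<mu>) (edge_y g q w sh c s (-1) \<mu>)"
      "c \<in> active g sh" "s \<in> {-1, 1}" "\<mu> < gnum q"
      using a2 unfolding is_max_def speeds_y_def by blast
    then have "edge_y g q w sh c s 1 \<mu> \<in> Gset" "edge_y g q w sh c s (-1) \<mu> \<in> Gset"
      by (auto intro: Gy)
    from vel_le_alpha(1)[OF eos this, of 2] show ?thesis unfolding *(1) by linarith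
  qed
  define S where "S = a1 / dx g + a2 / dy g"
  have S: "S > 0" using a1_pos a2_pos d by (simp add: S_def add_pos_pos)
  \<comment> \<open>Positivity can be read off from the CFL condition, whose left side is
    positive.\<close>
  have om_pos: "om > 0"
  proof -
    have "0 < th * om" using cfl mult_pos_pos[OF dt S] unfolding S_def by linarith
    then show ?thesis using zero_less_mult_pos th(2) by blast
  qed
  have cw: "cwx q = om * (a1 / dx g / S)" "cwy q = om * (a2 / dy g / S)"
    using cad by (simp_all add: improved_cad_def S_def)
  have cw_pos: "cwx q > 0" "cwy q > 0"
    using om_pos a1_pos a2_pos d S by (simp_all add: cw)
  \<comment> \<open>The edge weights split \<open>om\<close> in proportion to
    \<open>a1 / dx g\<close> and \<open>a2 / dy g\<close>, so multiplying the CFL condition by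
    either share gives the condition for that direction.\<close>
  have cfl': "dt * b \<le> th * (om * (b / S)) / 2" if "b \<ge> 0" for b
  proof -
    have "dt * b = dt * S * (b / S)" using S by simp
    also have "\<dots> \<le> th * om / 2 * (b / S)"
      using cfl S that by (intro mult_right_mono) (simp_all add: S_def)
    finally show ?thesis by (simp add: mult_ac)
  qed
  have "U_next p g q w dt th sh c \<in> Gstar" if c: "c \<in> active g sh" for sh c
  proof -
    have div: "(1 / dx g) * (\<Sum>t\<in>{-1, 1}. \<Sum>\<mu><k + 1. gwt q \<mu> / 2 *
        (mag (edge_x g q w sh c 1 t \<mu>) $ 1 - mag (edge_x g q w sh c (-1) t \<mu>) $ 1))
      + (1 / dy g) * (\<Sum>s\<in>{-1, 1}. \<Sum>\<mu><k + 1. gwt q \<mu> / 2 *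
        (mag (edge_y g q w sh c s 1 \<mu>) $ 2 - mag (edge_y g q w sh c s (-1) \<mu>) $ 2)) = 0"
      \<comment> \<open>The field has degree at most \<open>k + 1\<close>, within the bound
        \<open>2 * (k + 1)\<close> for the Gauss rule applied to derivatives.\<close>
      using data by (intro discrete_divergence[OF grid gauss _ _ _ c, of "k + 1"]) (auto simp: cdg_data_def)
    have "c \<in> cells g sh" using grid c unfolding valid_grid_def by blast
    note step = U_next_affine_pos[OF _ _ _ d gauss _ _ cw_pos Ubar[OF this] qval[OF c] div _ _ th(2,3)]
    have speed1: "alpha p 1 (edge_x g q w sh c 1 t \<mu>) (edge_x g q w sh c (-1) t \<mu>) \<le> a1"
      if "t \<in> {-1, 1}" "\<mu> < k + 1" for t \<mu>
    proof -
      have "alpha p 1 (edge_x g q w sh c 1 t \<mu>) (edge_x g q w sh c (-1) t \<mu>) \<in> speeds_x p g q w"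
        unfolding speeds_x_def mem_Collect_eq N using c that by blast
      then show ?thesis using a1 unfolding is_max_def by blast
    qed
    have speed2: "alpha p 2 (edge_y g q w sh c s 1 \<mu>) (edge_y g q w sh c s (-1) \<mu>) \<le> a2"
      if "s \<in> {-1, 1}" "\<mu> < k + 1" for s \<mu>
    proof -
      have "alpha p 2 (edge_y g q w sh c s 1 \<mu>) (edge_y g q w sh c s (-1) \<mu>) \<in> speeds_y p g q w"
        unfolding speeds_y_def mem_Collect_eq N using c that by blast
      then show ?thesis using a2 unfolding is_max_def by blast
    qed
    have cad': "cad_rule k q" using cad by (simp add: improved_cad_def)
    have cflx: "dt * a1 / dx g \<le> th * cwx q / 2" "dt * a2 / dy g \<le> th * cwy q / 2"
      using cfl'[of "a1 / dx g"] cfl'[of "a2 / dy g"] a1_pos a2_pos d by (simp_all add: cw)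
    have "rho (U_next p g q w dt th sh c) + 0 > 0"
    proof (rule step)
      show "linear rho" by (rule linearI) (simp_all add: rho_def)
      show "rho U + 0 > 0" if "U \<in> Gset" for U using that by (simp add: Gset_def)
      show "rho (flux p l U - flux p l V)
          \<le> alpha p l U V * ((rho U + 0) + (rho V + 0)) + (mag U $ l - mag V $ l) * 0"
        if "U \<in> Gset" "V \<in> Gset" for l U V
        using flux_rho_bound[OF eos that] by simp
    qed (use cad' speed1 speed2 dt cflx in auto)
    moreover have "U_next p g q w dt th sh c \<bullet> nstar us Bs + 1/2 * (norm Bs)\<^sup>2 > 0" for us Bs
    proof (rule step)
      show "linear (\<lambda>U. U \<bullet> nstar us Bs)" by (rule linearI) (simp_all add: inner_add_left)
      show "U \<bullet> nstar us Bs + 1/2 * (norm Bs)\<^sup>2 > 0" if "U \<in> Gset" for U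
        using chi_pos[OF that] unfolding chi_def .
      show "(flux p l U - flux p l V) \<bullet> nstar us Bs \<le> alpha p l U V *
          ((U \<bullet> nstar us Bs + 1/2 * (norm Bs)\<^sup>2) + (V \<bullet> nstar us Bs + 1/2 * (norm Bs)\<^sup>2))
          + (mag U $ l - mag V $ l) * (us \<bullet> Bs)"
        if "U \<in> Gset" "V \<in> Gset" for l U V
        using flux_pair_nstar_bound[OF eos that] unfolding chi_def .
    qed (use cad' speed1 speed2 dt cflx in auto)
    moreover have "U \<bullet> (1, 0, 0, 0) = rho U" for U :: state
      by (cases U) (simp add: rho_def)
    ultimately show ?thesis by (simp add: Gstar_def)
  qed
  then show ?thesis by blast
qed

end
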